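(* Let $G$ be a finite abelian group of type $(m_1,\dots,m_r)$ and rank $r$. For every subset $A\subseteq G$ the following are equivalent: (i) $\operatorname{diam}^+_A(G)=\operatorname{diam}^+(G)$; (ii) there exists a standard generating set $\{e_1,\dots,e_r\}$ for $G$ such that one can write $A_0=A\cup\{0\}=\{0,a_1,\dots,a_r\}$ so that for each $i\in[1,r]$, either $a_i=e_i$, or $a_i=e_i+a_{\sigma(i)}$ for some $\sigma(i)\in[i+1,r]$. Moreover, if $A$ is as in (ii), then every $g\in G$ can be written uniquely as $g=\sum_{i=1}^r\lambda_i a_i$ with $\lambda_i\in[0,m_i-1]$ for all $i$, and for this representation $l^+_A(g)=\sum_{i=1}^r\lambda_i$.
   Context: Groups are written additively; $[x,y]$ denotes the set of integers $n$ with $x\le n\le y$. A finite abelian group $G$ has type $(m_1,\dots,m_r)$ if $G\cong \mathbb{Z}_{m_1}\oplus\dots\oplus\mathbb{Z}_{m_r}$ with $1\neq m_1\mid\dots\mid m_r$; $r$ is the rank. A standard generating set for $G$ is an ordered subset $\{a_1,\dots,a_r\}\subseteq G$ with $G=\langle a_1\rangle\oplus\dots\oplus\langle a_r\rangle$ and $\operatorname{ord}(a_i)=m_i$ for all $i$. For $A\subseteq G$ let $A_0:=A\cup\{0\}$ and $\langle A\rangle^+_\rho:=\rho A_0=\{a_1+\dots+a_\rho: a_i\in A_0\}$ for $\rho\in\mathbb{N}_0$. The length of $g\in G$ is $l^+_A(g):=\min\{\rho\in\mathbb{N}_0: g\in\langle A\rangle^+_\rho\}$ ($\min\varnothing=\infty$).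 $\operatorname{diam}^+_A(G):=\min\{\rho\in\mathbb{N}_0:\langle A\rangle^+_\rho=G\}$, and $\operatorname{diam}^+(G):=\max\{\operatorname{diam}^+_A(G): \langle A\rangle=G\}$. *)

theory Defs
  imports Main "HOL-Library.Extended_Nat"
begin

text \<open>The finite abelian group G is the universe of a type 'a of class
  {ab_group_add, finite}; groups are written additively.\<close>

primrec nmul :: "nat \<Rightarrow> 'a::ab_group_add \<Rightarrow> 'a" where
  "nmul 0 x = 0"
| "nmul (Suc n) x = x + nmul n x"

text \<open>Order of an element (finite group, so it exists).\<close>
definition ord_elem :: "'a::{ab_group_add,finite} \<Rightarrow> nat" where
  "ord_elem x = (LEAST k. 0 < k \<and> nmul k x = 0)"

text \<open>Cyclic subgroup generated by x (finite group: nonnegative multiples suffice).\<close>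
definition cyc :: "'a::{ab_group_add,finite} \<Rightarrow> 'a set" where
  "cyc x = range (\<lambda>k. nmul k x)"

definition gen :: "'a::ab_group_add set \<Rightarrow> 'a set" where
  "gen A = \<Inter>{H. 0 \<in> H \<and> (\<forall>x\<in>H. \<forall>y\<in>H. x + y \<in> H \<and> - x \<in> H) \<and> A \<subseteq> H}"

definition box :: "nat list \<Rightarrow> nat list set" where
  "box ms = {xs. length xs = length ms \<and> (\<forall>i<length ms. xs ! i < ms ! i)}"

definition addmod :: "nat list \<Rightarrow> nat list \<Rightarrow> nat list \<Rightarrow> nat list" where
  "addmod ms xs ys = map (\<lambda>i. (xs ! i + ys ! i) mod (ms ! i)) [0..<length ms]"

definition has_type :: "'a::{ab_group_add,finite} itself \<Rightarrow> nat list \<Rightarrow> bool" where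
  "has_type _ ms \<longleftrightarrow>
     (ms \<noteq> [] \<longrightarrow> ms ! 0 \<noteq> 1) \<and>
     (\<forall>i. Suc i < length ms \<longrightarrow> ms ! i dvd ms ! Suc i) \<and>
     (\<exists>\<phi> :: nat list \<Rightarrow> 'a. bij_betw \<phi> (box ms) UNIV \<and>
        (\<forall>x\<in>box ms. \<forall>y\<in>box ms. \<phi> (addmod ms x y) = \<phi> x + \<phi> y))"

definition std_gen :: "nat list \<Rightarrow> 'a::{ab_group_add,finite} list \<Rightarrow> bool" where
  "std_gen ms es \<longleftrightarrow> length es = length ms \<and>
     (\<forall>i<length ms. ord_elem (es ! i) = ms ! i) \<and>
     (\<forall>g. \<exists>!hs. length hs = length ms \<and> (\<forall>i<length ms. hs ! i \<in> cyc (es ! i)) \<and> g = sum_list hs)"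

definition sumset :: "'a::ab_group_add set \<Rightarrow> nat \<Rightarrow> 'a set" where
  "sumset A \<rho> = {sum_list xs | xs. length xs = \<rho> \<and> set xs \<subseteq> insert 0 A}"

definition lenA :: "'a::ab_group_add set \<Rightarrow> 'a \<Rightarrow> enat" where
  "lenA A g = (if \<exists>\<rho>. g \<in> sumset A \<rho> then enat (LEAST \<rho>. g \<in> sumset A \<rho>) else \<infinity>)"

definition diamA :: "'a::ab_group_add set \<Rightarrow> enat" where
  "diamA A = (if \<exists>\<rho>. sumset A \<rho> = UNIV then enat (LEAST \<rho>. sumset A \<rho> = UNIV) else \<infinity>)"

definition diamG :: "'a::{ab_group_add,finite} itself \<Rightarrow> enat" where
  "diamG _ = Max {diamA (B :: 'a set) | B. gen B = UNIV}"

definition cond_ii :: "nat list \<Rightarrow> 'a::{ab_group_add,finite} set \<Rightarrow> 'a list \<Rightarrow> 'a list \<Rightarrow> bool" where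
  "cond_ii ms A es as \<longleftrightarrow> std_gen ms es \<and> length as = length ms \<and>
     insert 0 A = insert 0 (set as) \<and>
     (\<forall>i<length ms. as ! i = es ! i \<or>
        (\<exists>j. i < j \<and> j < length ms \<and> as ! i = es ! i + as ! j))"

end

theory Submission
  imports Defs Complex_Main "HOL-Library.FuncSet"
begin

text \<open>Order a generating set greedily, \<open>b\<^sub>0, b\<^sub>1, \<dots>\<close>, always taking an element of maximal order
  \<open>c\<^sub>k\<close> modulo the span of its predecessors. Then \<open>c\<close> is decreasing, every element is uniquely
  \<open>\<Sum> \<lambda>\<^sub>k b\<^sub>k\<close> with \<open>\<lambda>\<^sub>k < c\<^sub>k\<close>, and \<open>c\<^sub>0 \<cdots> c\<^sub>k\<^sub>-\<^sub>1\<close>, being the order of a subgroup with \<open>k\<close>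
  generators, is at most the product of the \<open>k\<close> largest invariants \<open>M\<^sub>0, \<dots>, M\<^sub>k\<^sub>-\<^sub>1\<close>.
  By logarithmic majorization \<open>\<Sum> (c\<^sub>k - 1) \<le> \<Sum> (M\<^sub>k - 1)\<close>, with equality only if \<open>c = M\<close>.

  If the diameter is \<open>\<Sum> (M\<^sub>k - 1)\<close>, the length of every element is therefore its digit sum. As
  \<open>M\<^sub>k G\<close> consists of the elements whose digits are divisible by \<open>M\<^sub>k\<close> and vanish from index \<open>k\<close> on,
  while \<open>M\<^sub>k b\<^sub>k\<close> has length at most \<open>M\<^sub>k\<close>, we get \<open>M\<^sub>k b\<^sub>k = 0\<close> or \<open>M\<^sub>k b\<^sub>k = M\<^sub>k b\<^sub>j\<close> with \<open>j < k\<close>;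
  so \<open>b\<^sub>k\<close> or \<open>b\<^sub>k - b\<^sub>j\<close> is killed by \<open>M\<^sub>k\<close>. Conversely, the relations \<open>m\<^sub>i a\<^sub>i = m\<^sub>i a\<^sub>\<sigma>\<^sub>(\<^sub>i\<^sub>)\<close> allow
  digits to be carried to the right without increasing the digit sum.\<close>

section \<open>Multiples and nonnegative combinations\<close>

lemma nmul_add: "nmul (m + n) x = nmul m x + nmul n x"
  by (induction m) (auto simp: add.assoc)

lemma nmul_mult: "nmul (m * n) x = nmul m (nmul n x)"
  by (induction m) (auto simp: nmul_add)

lemma nmul_zero [simp]: "nmul n 0 = 0"
  by (induction n) auto

lemma nmul_one [simp]: "nmul (Suc 0) x = x"
  by simp

lemma nmul_add_right: "nmul n (x + y) = nmul n x + nmul n y"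
  by (induction n) (auto simp: algebra_simps)

lemma nmul_diff_right: "nmul n (x - y) = nmul n x - nmul n y"
  by (induction n) (auto simp: algebra_simps)

lemma nmul_sum: "nmul n (sum f S) = (\<Sum>i\<in>S. nmul n (f i))"
  by (induction S rule: infinite_finite_induct) (auto simp: nmul_add_right)

lemma nmul_diff_left: "m \<le> n \<Longrightarrow> nmul (n - m) x = nmul n x - nmul m x"
  using nmul_add[of "n - m" m x] by (simp add: algebra_simps)

lemma nmul_mod: "nmul m x = 0 \<Longrightarrow> nmul (k mod m) x = nmul k x"
  by (metis add_0 mult.commute mult_div_mod_eq nmul_add nmul_mult nmul_zero)

lemma ex_nmul_zero:
  fixes x :: "'a::{ab_group_add,finite}"
  shows "\<exists>n>0. nmul n x = 0"
proof -
  have "\<not> inj (\<lambda>n. nmul n x)"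
    using finite_imageD[of "\<lambda>n. nmul n x" UNIV] by auto
  then obtain m n where "m \<noteq> n" "nmul m x = nmul n x"
    by (auto simp: inj_on_def)
  then obtain m n where "m < n" "nmul m x = nmul n x"
    by (metis nat_neq_iff)
  then have "n - m > 0" "nmul (n - m) x = 0"
    by (auto simp: nmul_diff_left)
  then show ?thesis by blast
qed

lemma nmul_closed:
  assumes "0 \<in> S" "\<And>x y. x \<in> S \<Longrightarrow> y \<in> S \<Longrightarrow> x + y \<in> S" "x \<in> S"
  shows "nmul n x \<in> S"
  using assms by (induction n) auto

text \<open>In a finite group the inverse of an element is one of its multiples, so closure under
  addition already gives a subgroup and natural coefficients suffice throughout.\<close>

lemma uminus_closed:
  fixes x :: "'a::{ab_group_add,finite}"
  assumes "0 \<in> S" "\<And>x y. x \<in> S \<Longrightarrow> y \<in> S \<Longrightarrow> x + y \<in> S" "x \<in> S"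
  shows "- x \<in> S"
proof -
  obtain n where "n > 0" "nmul n x = 0"
    using ex_nmul_zero by blast
  then have "- x = nmul (n - 1) x"
    by (intro minus_unique) (cases n, auto)
  then show ?thesis
    using nmul_closed[OF assms, of "n - 1"] by simp
qed

lemma gen_eq_UNIV_imp:
  fixes A :: "'a::{ab_group_add,finite} set"
  assumes "gen A = UNIV" "0 \<in> S" "\<And>x y. x \<in> S \<Longrightarrow> y \<in> S \<Longrightarrow> x + y \<in> S" "A \<subseteq> S"
  shows "S = UNIV"
proof -
  have "- x \<in> S" if "x \<in> S" for x
    using assms(2,3) that by (rule uminus_closed)
  then have "gen A \<subseteq> S"
    unfolding gen_def using assms(2-4) by (intro Inter_lower) blast
  then show ?thesis using assms(1) by auto
qed

definition comb :: "nat \<Rightarrow> (nat \<Rightarrow> 'a::ab_group_add) \<Rightarrow> (nat \<Rightarrow> nat) \<Rightarrow> 'a" where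
  "comb k x n = (\<Sum>i<k. nmul (n i) (x i))"

lemma comb_0 [simp]: "comb 0 x n = 0"
  by (simp add: comb_def)

lemma comb_Suc [simp]: "comb (Suc k) x n = comb k x n + nmul (n k) (x k)"
  by (simp add: comb_def)

lemma comb_cong:
  "k = k' \<Longrightarrow> (\<And>i. i < k' \<Longrightarrow> nmul (n i) (x i) = nmul (n' i) (x' i)) \<Longrightarrow> comb k x n = comb k' x' n'"
  by (simp add: comb_def)

lemma comb_add: "comb k x n + comb k x n' = comb k x (\<lambda>i. n i + n' i)"
  by (simp add: comb_def nmul_add sum.distrib)

lemma nmul_comb: "nmul d (comb k x n) = comb k x (\<lambda>i. d * n i)"
  by (simp add: comb_def nmul_sum nmul_mult)

lemma comb_zero [simp]: "comb k x (\<lambda>_. 0) = 0"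
  by (simp add: comb_def)

lemma comb_single: "j < k \<Longrightarrow> comb k x (\<lambda>i. if i = j then d else 0) = nmul d (x j)"
  unfolding comb_def by (subst sum.remove[of _ j]) auto

lemma comb_extend: "k \<le> N \<Longrightarrow> comb N x (\<lambda>i. if i < k then n i else 0) = comb k x n"
  unfolding comb_def by (rule sum.mono_neutral_cong_right) auto

lemma comb_in_range_closed:
  assumes "0 \<in> S" "\<And>x y. x \<in> S \<Longrightarrow> y \<in> S \<Longrightarrow> x + y \<in> S" "\<And>i. i < k \<Longrightarrow> x i \<in> S"
  shows "comb k x n \<in> S"
  using assms(3) by (induction k) (simp_all add: assms(1,2) nmul_closed)

lemma range_comb_0: "0 \<in> range (comb k x)"
  by (metis comb_zero rangeI)

lemma range_comb_add: "g \<in> range (comb k x) \<Longrightarrow> h \<in> range (comb k x) \<Longrightarrow> g + h \<in> range (comb k x)"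
  by (auto simp: comb_add)

lemma range_comb_diff:
  fixes x :: "nat \<Rightarrow> 'a::{ab_group_add,finite}"
  assumes "g \<in> range (comb k x)" "h \<in> range (comb k x)"
  shows "g - h \<in> range (comb k x)"
proof -
  have "- h \<in> range (comb k x)"
    using range_comb_0 range_comb_add assms(2) by (rule uminus_closed)
  then have "g + - h \<in> range (comb k x)" by (rule range_comb_add[OF assms(1)])
  then show ?thesis by simp
qed

lemma range_comb_mono: "k \<le> l \<Longrightarrow> range (comb k x) \<subseteq> range (comb l x)"
  by (metis (no_types, lifting) comb_extend image_subset_iff rangeI)

lemma range_comb_member: "i < k \<Longrightarrow> x i \<in> range (comb k x)"
  using comb_single[of i k x 1] by (metis One_nat_def nmul_one rangeI)

lemma comb_eq_UNIV_transfer: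
  assumes "range (comb k x) = UNIV" "\<And>i. i < k \<Longrightarrow> x i \<in> range (comb l y)"
  shows "range (comb l y) = UNIV"
proof -
  have "comb k x n \<in> range (comb l y)" for n
    using comb_in_range_closed[of "range (comb l y)" k x n] assms(2) range_comb_0 range_comb_add
    by blast
  then show ?thesis using assms(1) by (metis UNIV_eq_I UNIV_I imageE)
qed

section \<open>Counting digit expansions\<close>

text \<open>Extensional functions make the set finite and equality mean agreement below
  \<open>k\<close>. The predicates \<open>unique_digits\<close> and \<open>all_digits\<close> range
  over arbitrary functions instead, which saves restrictions later.\<close>

definition digits :: "(nat \<Rightarrow> nat) \<Rightarrow> nat \<Rightarrow> (nat \<Rightarrow> nat) set" where
  "digits c k = (\<Pi>\<^sub>E i\<in>{..<k}. {..<c i})"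

lemma finite_digits [simp]: "finite (digits c k)"
  by (simp add: digits_def finite_PiE)

lemma card_digits: "card (digits c k) = (\<Prod>i<k. c i)"
  by (simp add: digits_def card_PiE)

lemma restrict_in_digits: "(\<And>i. i < k \<Longrightarrow> n i < c i) \<Longrightarrow> restrict n {..<k} \<in> digits c k"
  by (auto simp: digits_def)

lemma comb_restrict [simp]: "comb k x (restrict n {..<k}) = comb k x n"
  by (rule comb_cong) auto

lemma digits_less: "n \<in> digits c k \<Longrightarrow> i < k \<Longrightarrow> n i < c i"
  by (auto simp: digits_def)

lemma digits_eqI: "n \<in> digits c k \<Longrightarrow> n' \<in> digits c k \<Longrightarrow> (\<And>i. i < k \<Longrightarrow> n i = n' i) \<Longrightarrow> n = n'"
  unfolding digits_def by (rule PiE_ext) auto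

definition unique_digits :: "(nat \<Rightarrow> nat) \<Rightarrow> nat \<Rightarrow> (nat \<Rightarrow> 'a::ab_group_add) \<Rightarrow> bool" where
  "unique_digits c k x \<longleftrightarrow> (\<forall>n n'. (\<forall>i<k. n i < c i) \<longrightarrow> (\<forall>i<k. n' i < c i) \<longrightarrow>
     comb k x n = comb k x n' \<longrightarrow> (\<forall>i<k. n i = n' i))"

definition all_digits :: "(nat \<Rightarrow> nat) \<Rightarrow> nat \<Rightarrow> (nat \<Rightarrow> 'a::ab_group_add) \<Rightarrow> bool" where
  "all_digits c k x \<longleftrightarrow> (\<forall>n. \<exists>n'. (\<forall>i<k. n' i < c i) \<and> comb k x n' = comb k x n)"

lemma unique_digitsD:
  assumes "unique_digits c k x" "comb k x n = comb k x n'"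
    "\<And>i. i < k \<Longrightarrow> n i < c i" "\<And>i. i < k \<Longrightarrow> n' i < c i" "i < k"
  shows "n i = n' i"
  using assms unfolding unique_digits_def by blast

lemma unique_digits_inj_on: "unique_digits c k x \<longleftrightarrow> inj_on (comb k x) (digits c k)"
proof
  assume "unique_digits c k x"
  then show "inj_on (comb k x) (digits c k)"
    by (intro inj_onI digits_eqI) (auto intro: unique_digitsD digits_less)
next
  assume inj: "inj_on (comb k x) (digits c k)"
  show "unique_digits c k x"
    unfolding unique_digits_def
  proof (intro allI impI)
    fix n n' i
    assume "\<forall>i<k. n i < c i" "\<forall>i<k. n' i < c i" "comb k x n = comb k x n'" "i < k"
    then have "restrict n {..<k} = restrict n' {..<k}"
      by (intro inj_onD[OF inj]) (auto intro: restrict_in_digits)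
    then show "n i = n' i"
      using \<open>i < k\<close> by (metis lessThan_iff restrict_apply')
  qed
qed

lemma all_digits_image: "all_digits c k x \<longleftrightarrow> comb k x ` digits c k = range (comb k x)"
proof
  assume all: "all_digits c k x"
  have "comb k x n \<in> comb k x ` digits c k" for n
  proof -
    obtain n' where "\<forall>i<k. n' i < c i" "comb k x n' = comb k x n"
      using all unfolding all_digits_def by blast
    then show ?thesis
      using restrict_in_digits[of k n' c] by (metis comb_restrict image_eqI)
  qed
  then show "comb k x ` digits c k = range (comb k x)" by blast
next
  assume "comb k x ` digits c k = range (comb k x)"
  then show "all_digits c k x"
    unfolding all_digits_def by (metis (no_types, lifting) digits_less image_iff rangeI)
qed

lemma card_range_comb:
  "unique_digits c k x \<Longrightarrow> all_digits c k x \<Longrightarrow> card (range (comb k x)) = (\<Prod>i<k. c i)"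
  by (metis all_digits_image card_digits card_image unique_digits_inj_on)

text \<open>A map from a finite set onto a set of the same size is injective. Independence of
  standard generating sets and of the \<open>as\<close> in (ii) is obtained this way.\<close>

lemma unique_digitsI_card:
  "all_digits c k x \<Longrightarrow> card (range (comb k x)) = (\<Prod>i<k. c i) \<Longrightarrow> unique_digits c k x"
  by (metis all_digits_image card_digits eq_card_imp_inj_on finite_digits unique_digits_inj_on)

lemma torsion_all_digits:
  assumes "\<And>i. i < k \<Longrightarrow> nmul (c i) (x i) = 0" "\<And>i. i < k \<Longrightarrow> 0 < c i"
  shows "all_digits c k x"
  unfolding all_digits_def
proof
  fix n
  have "comb k x (\<lambda>i. n i mod c i) = comb k x n"
    using assms by (intro comb_cong) (auto simp: nmul_mod)
  then show "\<exists>n'. (\<forall>i<k. n' i < c i) \<and> comb k x n' = comb k x n"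
    using assms by (intro exI[of _ "\<lambda>i. n i mod c i"]) auto
qed

section \<open>Sumsets, lengths and diameters\<close>

lemma sumset_0: "0 \<in> sumset A 0"
  by (simp add: sumset_def)

lemma sumset_1: "x \<in> insert 0 A \<Longrightarrow> x \<in> sumset A 1"
  unfolding sumset_def by (intro CollectI exI[of _ "[x]"]) auto

lemma sumset_add: "g \<in> sumset A p \<Longrightarrow> h \<in> sumset A q \<Longrightarrow> g + h \<in> sumset A (p + q)"
  unfolding sumset_def
proof (elim CollectE exE conjE)
  fix xs ys
  assume "g = sum_list xs" "length xs = p" "set xs \<subseteq> insert 0 A"
    "h = sum_list ys" "length ys = q" "set ys \<subseteq> insert 0 A"
  then show "g + h \<in> {sum_list xs |xs. length xs = p + q \<and> set xs \<subseteq> insert 0 A}"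
    by (intro CollectI exI[of _ "xs @ ys"]) auto
qed

lemma zero_in_sumset: "0 \<in> sumset (A :: 'a::ab_group_add set) p"
proof -
  have "sum_list (replicate p 0) = (0 :: 'a)" by (induction p) auto
  then show ?thesis
    unfolding sumset_def by (intro CollectI exI[of _ "replicate p 0"]) auto
qed

lemma sumset_mono: "p \<le> q \<Longrightarrow> sumset A p \<subseteq> sumset A q"
  using sumset_add[of _ A p 0 "q - p"] zero_in_sumset by fastforce

lemma nmul_in_sumset: "x \<in> insert 0 A \<Longrightarrow> nmul n x \<in> sumset A n"
proof (induction n)
  case (Suc n)
  then show ?case using sumset_add[of x A 1 "nmul n x" n] sumset_1[of x A] by simp
qed (simp add: sumset_0)

lemma comb_in_sumset:
  "(\<And>i. i < k \<Longrightarrow> x i \<in> insert 0 A) \<Longrightarrow> comb k x n \<in> sumset A (\<Sum>i<k. n i)"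
  by (induction k) (auto simp: sumset_0 intro!: sumset_add nmul_in_sumset)

text \<open>Equal summands are collected into coefficients; summands 0 are dropped, hence only an
  inequality.\<close>

lemma sumset_as_comb:
  assumes "insert 0 A \<subseteq> insert 0 (a ` {..<k})" "g \<in> sumset A p"
  shows "\<exists>n. g = comb k a n \<and> (\<Sum>i<k. n i) \<le> p"
proof -
  have "\<exists>n. sum_list xs = comb k a n \<and> (\<Sum>i<k. n i) \<le> length xs" if "set xs \<subseteq> insert 0 A" for xs
    using that
  proof (induction xs)
    case Nil
    then show ?case by (intro exI[of _ "\<lambda>_. 0"]) auto
  next
    case (Cons y ys)
    then obtain n where n: "sum_list ys = comb k a n" "(\<Sum>i<k. n i) \<le> length ys"
      by auto
    show ?case
    proof (cases "y = 0")
      case False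
      then obtain j where j: "j < k" "y = a j"
        using Cons.prems assms(1) by auto
      have "(\<Sum>i<k. (if i = j then 1 else 0) + n i) = Suc (\<Sum>i<k. n i)"
        using j by (simp add: sum.distrib)
      moreover have "y + sum_list ys = comb k a (\<lambda>i. (if i = j then 1 else 0) + n i)"
        using comb_single[OF j(1), of a 1] j(2) n(1) by (simp flip: comb_add)
      ultimately show ?thesis using n(2) by (intro exI[of _ "\<lambda>i. (if i = j then 1 else 0) + n i"]) auto
    qed (use n in auto)
  qed
  then show ?thesis using assms(2) unfolding sumset_def by blast
qed

lemma lenA_eqI:
  assumes "g \<in> sumset A p" "\<And>q. g \<in> sumset A q \<Longrightarrow> p \<le> q"
  shows "lenA A g = enat p"
proof -
  have "(LEAST q. g \<in> sumset A q) = p"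
    using assms by (rule Least_equality)
  then show ?thesis using assms(1) unfolding lenA_def by metis
qed

lemma diamA_le: "sumset A p = UNIV \<Longrightarrow> diamA A \<le> enat p"
  unfolding diamA_def using Least_le[of "\<lambda>p. sumset A p = UNIV" p] by auto

lemma diamA_eq_enatD:
  assumes "diamA A = enat p"
  shows "sumset A p = UNIV" "q < p \<Longrightarrow> sumset A q \<noteq> UNIV"
proof -
  have ex: "\<exists>q. sumset A q = UNIV" and p: "p = (LEAST q. sumset A q = UNIV)"
    using assms unfolding diamA_def by (auto split: if_splits)
  show "sumset A p = UNIV" unfolding p by (rule LeastI_ex[OF ex])
  show "q < p \<Longrightarrow> sumset A q \<noteq> UNIV" unfolding p by (rule not_less_Least)
qed

lemma diamA_eq_enatI:
  assumes "sumset A p = UNIV" "\<And>q. sumset A q = UNIV \<Longrightarrow> p \<le> q"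
  shows "diamA A = enat p"
proof -
  have "(LEAST q. sumset A q = UNIV) = p"
    using assms by (rule Least_equality)
  then show ?thesis using assms(1) unfolding diamA_def by metis
qed

text \<open>Condition (i) does not assume that \<open>A\<close> generates the group; a finite
  diameter forces it.\<close>

lemma sumset_UNIV_imp_gen:
  assumes "sumset A p = UNIV"
  shows "gen A = UNIV"
proof -
  have "g \<in> H" if "0 \<in> H" "\<forall>x\<in>H. \<forall>y\<in>H. x + y \<in> H \<and> - x \<in> H" "A \<subseteq> H" for g H
  proof -
    obtain xs where "g = sum_list xs" "set xs \<subseteq> insert 0 A"
      using assms unfolding sumset_def by blast
    moreover have "set xs \<subseteq> H \<Longrightarrow> sum_list xs \<in> H"
      using that(1,2) by (induction xs) auto
    ultimately show ?thesis using that(1,3) by auto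
  qed
  then show ?thesis unfolding gen_def by blast
qed

section \<open>Carrying\<close>

text \<open>As \<open>m\<close> copies of \<open>a k\<close> equal \<open>m\<close> copies of
  \<open>a j\<close>, the block of \<open>n k div m * m\<close> copies moves from \<open>k\<close>
  to \<open>j\<close> without changing the number of summands.\<close>

lemma carry_step:
  assumes "k < j" "j < r" "nmul m (a k) = nmul m (a j)"
  shows "comb r a (n(k := n k mod m, j := n j + n k div m * m)) = comb r a n"
    and "(\<Sum>i<r. (n(k := n k mod m, j := n j + n k div m * m)) i) = (\<Sum>i<r. n i)"
proof -
  let ?n = "n(k := n k mod m, j := n j + n k div m * m)"
  have split: "sum f {..<r} = f k + (f j + sum f ({..<r} - {k} - {j}))" for f :: "nat \<Rightarrow> 'b::comm_monoid_add"
    using assms(1,2) by (simp add: sum.remove[of _ k] sum.remove[of _ j])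
  have rest: "(\<Sum>i\<in>{..<r} - {k} - {j}. nmul (?n i) (a i)) = (\<Sum>i\<in>{..<r} - {k} - {j}. nmul (n i) (a i))"
    "(\<Sum>i\<in>{..<r} - {k} - {j}. ?n i) = (\<Sum>i\<in>{..<r} - {k} - {j}. n i)"
    by (auto intro: sum.cong)
  have "nmul (n k mod m) (a k) + nmul (n k div m * m) (a j) = nmul (n k) (a k)"
    by (metis add.commute assms(3) div_mult_mod_eq nmul_add nmul_mult)
  then show "comb r a ?n = comb r a n"
    unfolding comb_def split[of "\<lambda>i. nmul (?n i) (a i)"] split[of "\<lambda>i. nmul (n i) (a i)"] rest
    using assms(1) by (simp add: nmul_add algebra_simps)
  show "(\<Sum>i<r. ?n i) = (\<Sum>i<r. n i)"
    unfolding split[of ?n] split[of n] rest using assms(1) by simp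
qed

text \<open>Digits are reduced from left to right. Carries go strictly to the right, so reduced
  digits stay reduced. A carry keeps the digit sum; when \<open>m i\<close> kills
  \<open>a i\<close>, the digit is just cut down.\<close>

lemma carry:
  assumes pos: "\<And>i. i < r \<Longrightarrow> 0 < m i"
    and rel: "\<And>i. i < r \<Longrightarrow> nmul (m i) (a i) = 0 \<or> (\<exists>j. i < j \<and> j < r \<and> nmul (m i) (a i) = nmul (m i) (a j))"
  shows "\<exists>n'. (\<forall>i<r. n' i < m i) \<and> comb r a n' = comb r a n \<and> (\<Sum>i<r. n' i) \<le> (\<Sum>i<r. n i)"
proof -
  have "k \<le> r \<Longrightarrow> \<exists>n'. (\<forall>i<k. n' i < m i) \<and> comb r a n' = comb r a n \<and> (\<Sum>i<r. n' i) \<le> (\<Sum>i<r. n i)" for k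
  proof (induction k)
    case 0
    then show ?case by auto
  next
    case (Suc k)
    then have k: "k < r" by simp
    from Suc obtain l where l: "\<forall>i<k. l i < m i" "comb r a l = comb r a n" "(\<Sum>i<r. l i) \<le> (\<Sum>i<r. n i)"
      by auto
    from rel[OF k] show ?case
    proof (elim disjE exE conjE)
      assume 0: "nmul (m k) (a k) = 0"
      define l' where "l' = l(k := l k mod m k)"
      have "comb r a l' = comb r a l"
        using 0 unfolding l'_def by (intro comb_cong) (auto simp: nmul_mod)
      moreover have "(\<Sum>i<r. l' i) \<le> (\<Sum>i<r. l i)"
        unfolding l'_def by (intro sum_mono) auto
      moreover have "\<forall>i<Suc k. l' i < m i"
        using l(1) pos[OF k] unfolding l'_def by (auto simp: less_Suc_eq)
      ultimately show ?thesis using l(2,3) by (metis order_trans)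
    next
      fix j
      assume j: "k < j" "j < r" "nmul (m k) (a k) = nmul (m k) (a j)"
      define l' where "l' = l(k := l k mod m k, j := l j + l k div m k * m k)"
      have "\<forall>i<Suc k. l' i < m i"
        using l(1) pos[OF k] j(1) unfolding l'_def by (auto simp: less_Suc_eq)
      moreover have "comb r a l' = comb r a l" "(\<Sum>i<r. l' i) = (\<Sum>i<r. l i)"
        unfolding l'_def by (rule carry_step[OF j])+
      ultimately show ?thesis using l(2,3) by metis
    qed
  qed
  from this[of r] show ?thesis by simp
qed

section \<open>Logarithmic majorization\<close>

text \<open>Abel summation as an induction: partial sums of \<open>L\<close> are nonnegative, so
  replacing the weight \<open>c k\<close> by \<open>c (Suc k)\<close> can only lower the left side
  of the invariant.\<close>

lemma antitone_weighted_sum_nonneg: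
  fixes c L :: "nat \<Rightarrow> real"
  assumes "\<And>k. c (Suc k) \<le> c k" "\<And>k. 0 \<le> c k" "\<And>k. k \<le> N \<Longrightarrow> 0 \<le> (\<Sum>i<k. L i)"
  shows "0 \<le> (\<Sum>i<N. c i * L i)"
proof -
  have "k \<le> N \<Longrightarrow> c k * (\<Sum>i<k. L i) \<le> (\<Sum>i<k. c i * L i)" for k
  proof (induction k)
    case (Suc k)
    have "c (Suc k) * (\<Sum>i<Suc k. L i) \<le> c k * (\<Sum>i<Suc k. L i)"
      using assms(1) assms(3)[OF Suc.prems] by (rule mult_right_mono)
    also have "\<dots> = c k * (\<Sum>i<k. L i) + c k * L k" by (simp add: algebra_simps)
    finally show ?case using Suc by simp
  qed simp
  from this[of N] show ?thesis using assms(2,3)[of N] by (smt (verit) mult_nonneg_nonneg order_refl)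
qed

text \<open>From \<open>ln x <= x - 1\<close> with \<open>x = M i / c i\<close>, each
  \<open>M i - c i\<close> is at least \<open>c i * ln x\<close>. The prefix products make the
  partial sums of the logarithms nonnegative, so Abel summation applies. Equality forces
  \<open>ln x = x - 1\<close>, hence \<open>x = 1\<close>, in every term.\<close>

lemma log_majorization:
  fixes c M :: "nat \<Rightarrow> nat"
  assumes anti: "\<And>k. c (Suc k) \<le> c k" and pos: "\<And>k. 0 < c k" "\<And>k. 0 < M k"
    and prods: "\<And>k. k \<le> N \<Longrightarrow> (\<Prod>i<k. c i) \<le> (\<Prod>i<k. M i)"
  shows "(\<Sum>i<N. c i) \<le> (\<Sum>i<N. M i)"
    and "(\<Sum>i<N. c i) = (\<Sum>i<N. M i) \<Longrightarrow> i < N \<Longrightarrow> c i = M i"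
proof -
  let ?L = "\<lambda>i. ln (real (M i) / real (c i))"
  have nonneg: "0 \<le> (\<Sum>i<N. real (c i) * ?L i)"
  proof (rule antitone_weighted_sum_nonneg)
    fix k assume "k \<le> N"
    have "(\<Sum>i<k. ?L i) = (\<Sum>i<k. ln (real (M i)) - ln (real (c i)))"
      using pos by (intro sum.cong) (auto simp: ln_div)
    also have "\<dots> = ln (real (\<Prod>i<k. M i)) - ln (real (\<Prod>i<k. c i))"
      using pos by (simp add: sum_subtractf ln_prod)
    finally have "(\<Sum>i<k. ?L i) = ln (real (\<Prod>i<k. M i)) - ln (real (\<Prod>i<k. c i))" .
    moreover have "ln (real (\<Prod>i<k. c i)) \<le> ln (real (\<Prod>i<k. M i))"
      using prods[OF \<open>k \<le> N\<close>] pos by (subst ln_le_cancel_iff) (auto simp del: of_nat_prod intro!: prod_pos)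
    ultimately show "0 \<le> (\<Sum>i<k. ?L i)" by simp
  qed (use anti in auto)
  have termwise: "real (c i) * ?L i \<le> real (M i) - real (c i)" for i
  proof -
    have "real (c i) * ?L i \<le> real (c i) * (real (M i) / real (c i) - 1)"
      using pos by (intro mult_left_mono ln_le_minus_one) auto
    also have "\<dots> = real (M i) - real (c i)" using pos(1)[of i] by (simp add: field_simps)
    finally show ?thesis .
  qed
  have "(\<Sum>i<N. real (c i) * ?L i) \<le> (\<Sum>i<N. real (M i) - real (c i))"
    by (intro sum_mono termwise)
  then have "real (\<Sum>i<N. c i) \<le> real (\<Sum>i<N. M i)"
    using nonneg by (simp add: sum_subtractf)
  then show "(\<Sum>i<N. c i) \<le> (\<Sum>i<N. M i)" by linarith
  assume eq: "(\<Sum>i<N. c i) = (\<Sum>i<N. M i)" and i: "i < N"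
  have "real (\<Sum>i<N. c i) = real (\<Sum>i<N. M i)" using eq by simp
  then have "(\<Sum>i<N. (real (M i) - real (c i)) - real (c i) * ?L i) \<le> 0"
    using nonneg by (simp add: sum_subtractf)
  moreover have "0 \<le> (\<Sum>i<N. (real (M i) - real (c i)) - real (c i) * ?L i)"
    using termwise by (intro sum_nonneg) simp
  ultimately have "(\<Sum>i<N. (real (M i) - real (c i)) - real (c i) * ?L i) = 0" by simp
  then have "(real (M i) - real (c i)) - real (c i) * ?L i = 0"
    using i termwise by (subst (asm) sum_nonneg_eq_0_iff) auto
  then have "?L i = real (M i) / real (c i) - 1"
    using pos(1)[of i] by (simp add: field_simps)
  then have "real (M i) / real (c i) = 1"
    using pos by (intro ln_eq_minus_one) auto
  then show "c i = M i" using pos(1)[of i] by (simp add: field_simps)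
qed

section \<open>Greedy generating sequences\<close>

text \<open>For a subgroup \<open>H\<close> this is the order of \<open>x\<close> in the quotient by
  \<open>H\<close>.\<close>

definition relord :: "'a::ab_group_add set \<Rightarrow> 'a \<Rightarrow> nat" where
  "relord H x = (LEAST n. 0 < n \<and> nmul n x \<in> H)"

lemma relord:
  fixes x :: "'a::{ab_group_add,finite}"
  assumes "0 \<in> H"
  shows "0 < relord H x" "nmul (relord H x) x \<in> H"
proof -
  have "\<exists>n. 0 < n \<and> nmul n x \<in> H" using ex_nmul_zero[of x] assms by auto
  from LeastI_ex[OF this] show "0 < relord H x" "nmul (relord H x) x \<in> H"
    unfolding relord_def by auto
qed

lemma relord_le: "0 < n \<Longrightarrow> nmul n x \<in> H \<Longrightarrow> relord H x \<le> n"
  unfolding relord_def by (intro Least_le) auto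

lemma relord_antimono:
  fixes x :: "'a::{ab_group_add,finite}"
  shows "0 \<in> H \<Longrightarrow> H \<subseteq> H' \<Longrightarrow> relord H' x \<le> relord H x"
  using relord[of H x] by (intro relord_le) auto

text \<open>With 0 as a candidate the choice exists even for empty \<open>A\<close>; 0 is an
  admissible summand in sumsets anyway.\<close>

definition pick :: "'a::ab_group_add set \<Rightarrow> 'a set \<Rightarrow> 'a" where
  "pick A H = (SOME x. x \<in> insert 0 A \<and> (\<forall>y\<in>insert 0 A. relord H y \<le> relord H x))"

lemma pick:
  fixes A :: "'a::{ab_group_add,finite} set"
  shows "pick A H \<in> insert 0 A" "y \<in> insert 0 A \<Longrightarrow> relord H y \<le> relord H (pick A H)"
proof -
  have "finite (relord H ` insert 0 A)" by simp
  then have "Max (relord H ` insert 0 A) \<in> relord H ` insert 0 A"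
    by (rule Max_in) simp
  then obtain x where x: "x \<in> insert 0 A" "relord H x = Max (relord H ` insert 0 A)"
    by (metis (no_types, lifting) imageE)
  then have "x \<in> insert 0 A \<and> (\<forall>y\<in>insert 0 A. relord H y \<le> relord H x)"
    by (metis Max_ge \<open>finite (relord H ` insert 0 A)\<close> imageI)
  then have "pick A H \<in> insert 0 A \<and> (\<forall>y\<in>insert 0 A. relord H y \<le> relord H (pick A H))"
    unfolding pick_def by (rule someI)
  then show "pick A H \<in> insert 0 A" "y \<in> insert 0 A \<Longrightarrow> relord H y \<le> relord H (pick A H)"
    by blast+
qed

text \<open>A choice depends on the earlier ones only through their span, so the recursion runs on
  spans and \<open>greedy\<close> reads off the elements.\<close>

primrec greedy_span :: "'a::ab_group_add set \<Rightarrow> nat \<Rightarrow> 'a set" where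
  "greedy_span A 0 = {0}"
| "greedy_span A (Suc k) = {h + nmul n (pick A (greedy_span A k)) | h n. h \<in> greedy_span A k}"

definition greedy :: "'a::ab_group_add set \<Rightarrow> nat \<Rightarrow> 'a" where
  "greedy A k = pick A (greedy_span A k)"

lemma greedy_span: "greedy_span A k = range (comb k (greedy A))"
proof (induction k)
  case (Suc k)
  have eq: "greedy_span A (Suc k) = {h + nmul n (greedy A k) | h n. h \<in> range (comb k (greedy A))}"
    unfolding greedy_span.simps(2) greedy_def[symmetric] by (simp only: Suc)
  show ?case
  proof (intro equalityI subsetI)
    fix g assume "g \<in> greedy_span A (Suc k)"
    then obtain m n where g: "g = comb k (greedy A) m + nmul n (greedy A k)"
      unfolding eq by auto
    have "comb k (greedy A) m = comb k (greedy A) (m(k := n))"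
      by (intro comb_cong) auto
    then have "g = comb (Suc k) (greedy A) (m(k := n))" using g by simp
    then show "g \<in> range (comb (Suc k) (greedy A))" by blast
  qed (auto simp: eq simp del: greedy_span.simps)
qed auto

definition greedy_ord :: "'a::ab_group_add set \<Rightarrow> nat \<Rightarrow> nat" where
  "greedy_ord A k = relord (range (comb k (greedy A))) (greedy A k)"

lemma greedy_mem: "greedy A k \<in> insert 0 (A :: 'a::{ab_group_add,finite} set)"
  unfolding greedy_def by (rule pick)

lemma greedy_ord_ge:
  fixes A :: "'a::{ab_group_add,finite} set"
  shows "y \<in> insert 0 A \<Longrightarrow> relord (range (comb k (greedy A))) y \<le> greedy_ord A k"
  using pick(2)[of y A "greedy_span A k"]
  unfolding greedy_ord_def greedy_span[symmetric] greedy_def .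

lemma greedy_ord_pos: "0 < greedy_ord (A :: 'a::{ab_group_add,finite} set) k"
  unfolding greedy_ord_def by (rule relord[OF range_comb_0])

text \<open>Enlarging the span cannot raise a relative order, and \<open>greedy A (Suc k)\<close>
  was already a candidate when the maximum was taken in step \<open>k\<close>.\<close>

lemma greedy_ord_antimono: "greedy_ord (A :: 'a::{ab_group_add,finite} set) (Suc k) \<le> greedy_ord A k"
proof -
  have "greedy_ord A (Suc k) \<le> relord (range (comb k (greedy A))) (greedy A (Suc k))"
    unfolding greedy_ord_def by (intro relord_antimono range_comb_0 range_comb_mono) simp
  also have "\<dots> \<le> greedy_ord A k" by (rule greedy_ord_ge[OF greedy_mem])
  finally show ?thesis .
qed

text \<open>Mixed radix expansion: \<open>greedy_ord A k\<close> copies of the last element lie in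
  the span of its predecessors, which absorbs the quotient of the top digit and leaves the
  remainder.\<close>

lemma greedy_all_digits:
  fixes A :: "'a::{ab_group_add,finite} set"
  shows "all_digits (greedy_ord A) k (greedy A)"
proof (induction k)
  case 0
  show ?case by (simp add: all_digits_def)
next
  case (Suc k)
  let ?b = "greedy A" and ?c = "greedy_ord A"
  show ?case
    unfolding all_digits_def
  proof
    fix n
    have "nmul (n k div ?c k) (nmul (?c k) (?b k)) \<in> range (comb k ?b)"
      unfolding greedy_ord_def by (intro nmul_closed range_comb_0 range_comb_add relord)
    then have "comb k ?b n + nmul (n k div ?c k) (nmul (?c k) (?b k)) \<in> range (comb k ?b)"
      by (intro range_comb_add) auto
    then obtain n1 where "comb k ?b n + nmul (n k div ?c k) (nmul (?c k) (?b k)) = comb k ?b n1"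
      by auto
    moreover obtain n2 where n2: "\<forall>i<k. n2 i < ?c i" "comb k ?b n2 = comb k ?b n1"
      using Suc unfolding all_digits_def by blast
    moreover have "nmul (n k) (?b k) = nmul (n k div ?c k) (nmul (?c k) (?b k)) + nmul (n k mod ?c k) (?b k)"
      by (metis div_mult_mod_eq nmul_add nmul_mult)
    moreover have "comb k ?b (n2(k := n k mod ?c k)) = comb k ?b n2"
      by (intro comb_cong) auto
    ultimately have "comb (Suc k) ?b (n2(k := n k mod ?c k)) = comb (Suc k) ?b n"
      by (simp add: algebra_simps)
    moreover have "\<forall>i<Suc k. (n2(k := n k mod ?c k)) i < ?c i"
      using n2 greedy_ord_pos[of A k] by (auto simp: less_Suc_eq)
    ultimately show "\<exists>n'. (\<forall>i<Suc k. n' i < ?c i) \<and> comb (Suc k) ?b n' = comb (Suc k) ?b n"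
      by blast
  qed
qed

text \<open>If two top digits differed, their difference would send the last element into the span
  of its predecessors while being smaller than its relative order. Lower digits follow by
  induction.\<close>

lemma greedy_unique_digits:
  fixes A :: "'a::{ab_group_add,finite} set"
  shows "unique_digits (greedy_ord A) k (greedy A)"
proof (induction k)
  case 0
  show ?case by (simp add: unique_digits_def)
next
  case (Suc k)
  let ?b = "greedy A" and ?c = "greedy_ord A"
  have le: "n k \<ge> n' k" if "comb (Suc k) ?b n = comb (Suc k) ?b n'" "n' k < ?c k" for n n'
  proof (rule ccontr)
    assume "\<not> n k \<ge> n' k"
    then have "nmul (n' k - n k) (?b k) = comb k ?b n - comb k ?b n'"
      using that(1) by (simp add: nmul_diff_left algebra_simps)
    also have "\<dots> \<in> range (comb k ?b)" by (intro range_comb_diff) auto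
    finally have "?c k \<le> n' k - n k"
      unfolding greedy_ord_def using \<open>\<not> n k \<ge> n' k\<close> by (intro relord_le) auto
    then show False using that(2) \<open>\<not> n k \<ge> n' k\<close> by simp
  qed
  show ?case
    unfolding unique_digits_def
  proof (intro allI impI)
    fix n n' i
    assume *: "\<forall>i<Suc k. n i < ?c i" "\<forall>i<Suc k. n' i < ?c i"
      "comb (Suc k) ?b n = comb (Suc k) ?b n'" "i < Suc k"
    have k: "n k = n' k"
      using le[OF *(3)] le[OF *(3)[symmetric]] *(1,2) by (simp add: antisym)
    with *(3) have "comb k ?b n = comb k ?b n'" by simp
    then have "i < k \<Longrightarrow> n i = n' i"
      using *(1,2) by (intro unique_digitsD[OF Suc]) auto
    then show "n i = n' i" using k *(4) by (auto simp: less_Suc_eq)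
  qed
qed

text \<open>Each order of at least 2 at least doubles the span, so order 1 occurs before index
  \<open>N\<close>. By maximality of the choice, all of \<open>A\<close> then lies in the
  span.\<close>

lemma greedy_span_UNIV:
  fixes A :: "'a::{ab_group_add,finite} set"
  assumes "gen A = UNIV" "card (UNIV :: 'a set) \<le> N"
  shows "range (comb N (greedy A)) = UNIV"
proof -
  have "\<exists>k<N. greedy_ord A k = 1"
  proof (rule ccontr)
    assume "\<not> ?thesis"
    then have "\<And>k. k < N \<Longrightarrow> 2 \<le> greedy_ord A k"
      using greedy_ord_pos[of A] by (metis One_nat_def Suc_1 Suc_leI le_neq_implies_less)
    then have "(\<Prod>i<N. 2) \<le> (\<Prod>i<N. greedy_ord A i)"
      by (intro prod_mono) auto
    also have "\<dots> = card (range (comb N (greedy A)))"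
      by (rule card_range_comb[OF greedy_unique_digits greedy_all_digits, symmetric])
    also have "\<dots> \<le> card (UNIV :: 'a set)" by (intro card_mono) auto
    finally show False using assms(2) less_exp[of N] by simp
  qed
  then obtain k where k: "k < N" "greedy_ord A k = 1" by blast
  let ?H = "range (comb k (greedy A))"
  have "y \<in> ?H" if "y \<in> A" for y
  proof -
    have "relord ?H y = 1"
      using greedy_ord_ge[of y A k] k(2) that relord(1)[OF range_comb_0, of k "greedy A" y] by simp
    then show ?thesis using relord(2)[OF range_comb_0, of k "greedy A" y] by simp
  qed
  then have "?H = UNIV"
    by (intro gen_eq_UNIV_imp[OF assms(1)] range_comb_0 range_comb_add) auto
  then show ?thesis using range_comb_mono[of k N "greedy A"] k(1) by auto
qed

section \<open>Groups with an independent generating sequence\<close>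

text \<open>The \<open>M i\<close> are the invariants of the group in decreasing order, padded with 1 up to the index \<open>N\<close>.\<close>

locale invariants =
  fixes M :: "nat \<Rightarrow> nat" and E :: "nat \<Rightarrow> 'a::{ab_group_add,finite}" and N :: nat
  assumes M_pos: "0 < M i"
    and M_dvd: "i \<le> j \<Longrightarrow> M j dvd M i"
    and E_torsion: "i < N \<Longrightarrow> nmul (M i) (E i) = 0"
    and E_span: "range (comb N E) = UNIV"
    and card_G: "card (UNIV :: 'a set) = (\<Prod>i<N. M i)"
    and N_ge: "card (UNIV :: 'a set) \<le> N"
begin

text \<open>Multiplication by \<open>M k\<close> kills the coordinates from \<open>k\<close> on,
  because \<open>M i\<close> divides \<open>M k\<close> there. For \<open>i < k\<close> only
  multiples of \<open>M k\<close> modulo \<open>M i\<close> remain, which are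
  \<open>M i div M k\<close> values.\<close>

lemma card_range_nmul_le:
  assumes "k \<le> N" "k = N \<longrightarrow> M k = 1"
  shows "card (range (nmul (M k) :: 'a \<Rightarrow> 'a)) \<le> (\<Prod>i<k. M i div M k)"
proof -
  let ?d = "M k" and ?q = "\<lambda>i. M i div M k"
  let ?f = "\<lambda>n. comb k E (\<lambda>i. ?d * n i)"
  have "nmul ?d g \<in> ?f ` digits ?q k" for g
  proof -
    obtain n where g: "g = comb N E n" using E_span by (metis UNIV_I imageE)
    let ?n = "\<lambda>i. n i mod ?q i"
    have "nmul ?d g = comb N E (\<lambda>i. if i < k then ?d * ?n i else 0)"
      unfolding g nmul_comb
    proof (rule comb_cong[OF refl])
      fix i assume "i < N"
      show "nmul (?d * n i) (E i) = nmul (if i < k then ?d * ?n i else 0) (E i)"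
      proof (cases "i < k")
        case True
        then have "?d * ?n i = (?d * n i) mod M i"
          using M_dvd[of i k] by (simp add: mult_mod_right)
        then show ?thesis using True \<open>i < N\<close> by (simp add: nmul_mod E_torsion)
      next
        case False
        then obtain t where "?d = M i * t" using M_dvd[of k i] by auto
        then have "?d * n i = (t * n i) * M i" by simp
        then show ?thesis using False \<open>i < N\<close> E_torsion[of i] by (simp only: nmul_mult) simp
      qed
    qed
    also have "\<dots> = ?f (restrict ?n {..<k})"
      by (subst comb_extend[OF assms(1)]) (auto intro: comb_cong)
    finally have "nmul ?d g = ?f (restrict ?n {..<k})" .
    moreover have "restrict ?n {..<k} \<in> digits ?q k"
      using M_pos M_dvd[of _ k] by (intro restrict_in_digits mod_less_divisor) (simp add: dvd_imp_le div_greater_zero_iff)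
    ultimately show ?thesis by (rule image_eqI)
  qed
  then have "card (range (nmul ?d :: 'a \<Rightarrow> 'a)) \<le> card (?f ` digits ?q k)"
    by (intro card_mono) auto
  also have "\<dots> \<le> card (digits ?q k)" by (intro card_image_le) simp
  finally show ?thesis by (simp add: card_digits)
qed

text \<open>Writing the coefficients as \<open>d q + s\<close> with \<open>d = M k\<close> and \<open>s < d\<close> shows that a subgroup with
  \<open>k\<close> generators has at most \<open>d ^ k\<close> times as many elements as \<open>d G\<close>.\<close>

lemma card_range_comb_le:
  fixes x :: "nat \<Rightarrow> 'a"
  assumes "k \<le> N"
  shows "card (range (comb k x)) \<le> (\<Prod>i<k. M i)"
proof (cases "k = N")
  case True
  then show ?thesis using card_mono[of UNIV "range (comb k x)"] card_G by simp
next
  case False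
  let ?d = "M k"
  let ?D = "range (nmul ?d :: 'a \<Rightarrow> 'a)"
  let ?f = "\<lambda>(h, n). h + comb k x n"
  have "comb k x n \<in> ?f ` (?D \<times> digits (\<lambda>_. ?d) k)" for n
  proof -
    have "comb k x n = nmul ?d (comb k x (\<lambda>i. n i div ?d)) + comb k x (restrict (\<lambda>i. n i mod ?d) {..<k})"
      by (simp add: nmul_comb comb_add)
    then show ?thesis
      using M_pos by (intro image_eqI[of _ _ "(nmul ?d (comb k x (\<lambda>i. n i div ?d)), restrict (\<lambda>i. n i mod ?d) {..<k})"])
        (auto intro!: restrict_in_digits)
  qed
  then have "card (range (comb k x)) \<le> card (?f ` (?D \<times> digits (\<lambda>_. ?d) k))"
    by (intro card_mono) auto
  also have "\<dots> \<le> card (?D \<times> digits (\<lambda>_. ?d) k)" by (intro card_image_le) simp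
  also have "\<dots> \<le> (\<Prod>i<k. M i div ?d) * (\<Prod>i<k. ?d)"
    using card_range_nmul_le[of k] assms False by (simp add: card_cartesian_product card_digits)
  also have "\<dots> = (\<Prod>i<k. M i)"
    unfolding prod.distrib[symmetric] using M_dvd by (intro prod.cong) auto
  finally show ?thesis .
qed

section \<open>Upper bound for the diameter of a generating set\<close>

definition diam_bound :: nat where
  "diam_bound = (\<Sum>i<N. M i - 1)"

text \<open>The product of the first \<open>k\<close> greedy orders is the size of a subgroup with
  \<open>k\<close> generators, so \<open>card_range_comb_le\<close> supplies the prefix inequalities
  of majorization.\<close>

lemma sum_greedy_ord_le:
  fixes A :: "'a set"
  shows "(\<Sum>i<N. greedy_ord A i) \<le> (\<Sum>i<N. M i)"
    and "(\<Sum>i<N. greedy_ord A i) = (\<Sum>i<N. M i) \<Longrightarrow> i < N \<Longrightarrow> greedy_ord A i = M i"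
proof -
  have prods: "(\<Prod>i<k. greedy_ord A i) \<le> (\<Prod>i<k. M i)" if "k \<le> N" for k
    using card_range_comb_le[OF that, of "greedy A"]
    unfolding card_range_comb[OF greedy_unique_digits greedy_all_digits] .
  show "(\<Sum>i<N. greedy_ord A i) \<le> (\<Sum>i<N. M i)"
    by (rule log_majorization(1)[OF greedy_ord_antimono greedy_ord_pos M_pos prods])
  show "(\<Sum>i<N. greedy_ord A i) = (\<Sum>i<N. M i) \<Longrightarrow> i < N \<Longrightarrow> greedy_ord A i = M i"
    by (rule log_majorization(2)[OF greedy_ord_antimono greedy_ord_pos M_pos prods])
qed

lemma greedy_expansion:
  fixes A :: "'a set"
  assumes "gen A = UNIV"
  obtains n where "\<And>i. i < N \<Longrightarrow> n i < greedy_ord A i" "g = comb N (greedy A) n"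
proof -
  obtain n where "g = comb N (greedy A) n"
    using greedy_span_UNIV[OF assms N_ge] by (metis UNIV_I imageE)
  then show ?thesis
    using greedy_all_digits[of A N] that unfolding all_digits_def by metis
qed

lemma sum_greedy_ord_diff: "(\<Sum>i<N. greedy_ord (A :: 'a set) i - 1) \<le> diam_bound"
  and sum_M: "(\<Sum>i<N. M i) = diam_bound + N"
  and sum_greedy_ord: "(\<Sum>i<N. greedy_ord A i) = (\<Sum>i<N. greedy_ord A i - 1) + N"
proof -
  have "(\<Sum>i<N. f i) = (\<Sum>i<N. f i - 1) + N" if "\<And>i. 0 < f i" for f :: "nat \<Rightarrow> nat"
  proof -
    have "(\<Sum>i<N. f i) = (\<Sum>i<N. (f i - 1) + 1)"
      using that by (intro sum.cong) (auto simp: Suc_leI)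
    also have "\<dots> = (\<Sum>i<N. f i - 1) + N" by (subst sum.distrib) simp
    finally show ?thesis .
  qed
  then show 1: "(\<Sum>i<N. M i) = diam_bound + N"
    and 2: "(\<Sum>i<N. greedy_ord A i) = (\<Sum>i<N. greedy_ord A i - 1) + N"
    using M_pos greedy_ord_pos[of A] unfolding diam_bound_def by auto
  show "(\<Sum>i<N. greedy_ord A i - 1) \<le> diam_bound"
    using sum_greedy_ord_le(1)[of A] 1 2 by simp
qed

lemma sumset_sum_greedy_ord:
  fixes A :: "'a set"
  assumes "gen A = UNIV"
  shows "sumset A (\<Sum>i<N. greedy_ord A i - 1) = UNIV"
proof -
  have "g \<in> sumset A (\<Sum>i<N. greedy_ord A i - 1)" for g
  proof -
    obtain n where n: "\<And>i. i < N \<Longrightarrow> n i < greedy_ord A i" "g = comb N (greedy A) n"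
      using greedy_expansion[OF assms] by blast
    have "g \<in> sumset A (\<Sum>i<N. n i)" unfolding n(2) by (intro comb_in_sumset greedy_mem)
    moreover have "(\<Sum>i<N. n i) \<le> (\<Sum>i<N. greedy_ord A i - 1)"
      using n(1) by (intro sum_mono) fastforce
    ultimately show ?thesis using sumset_mono by blast
  qed
  then show ?thesis by blast
qed

lemma sumset_diam_bound:
  fixes A :: "'a set"
  shows "gen A = UNIV \<Longrightarrow> sumset A diam_bound = UNIV"
  using sumset_sum_greedy_ord[of A] sumset_mono[OF sum_greedy_ord_diff, of A A] by blast

section \<open>Generating sets attaining the bound\<close>

context
  fixes A :: "'a set"
  assumes gen: "gen A = UNIV" and extremal: "\<forall>p<diam_bound. sumset A p \<noteq> UNIV"
begin

text \<open>Sums of \<open>greedy_ord A i - 1\<close> copies reach every element, so extremality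
  pushes their total number up to \<open>diam_bound\<close>: the equality case of
  majorization.\<close>

lemma extremal_greedy_ord: "i < N \<Longrightarrow> greedy_ord A i = M i"
proof (rule sum_greedy_ord_le(2))
  have "diam_bound \<le> (\<Sum>i<N. greedy_ord A i - 1)"
    using sumset_sum_greedy_ord[OF gen] extremal not_le by blast
  then show "(\<Sum>i<N. greedy_ord A i) = (\<Sum>i<N. M i)"
    using sum_greedy_ord_diff[of A] sum_M sum_greedy_ord[of A] by simp
qed

lemma extremal_expansion:
  obtains n where "\<And>i. i < N \<Longrightarrow> n i < M i" "g = comb N (greedy A) n"
  using greedy_expansion[OF gen, of g] extremal_greedy_ord by metis

text \<open>An element of length \<open>diam_bound\<close> can only be the one all of whose digits are maximal; a
  shorter expression of any other element would shorten that one.\<close>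

lemma extremal_length:
  assumes n: "\<And>i. i < N \<Longrightarrow> n i < M i" and mem: "comb N (greedy A) n \<in> sumset A p"
  shows "(\<Sum>i<N. n i) \<le> p"
proof (rule ccontr)
  assume p: "\<not> (\<Sum>i<N. n i) \<le> p"
  define top where "top = comb N (greedy A) (\<lambda>i. M i - 1)"
  have split: "(\<Sum>i<N. n i) + (\<Sum>i<N. M i - 1 - n i) = diam_bound"
    unfolding diam_bound_def sum.distrib[symmetric]
  proof (rule sum.cong[OF refl])
    fix i assume "i \<in> {..<N}"
    then show "n i + (M i - 1 - n i) = M i - 1" using n[of i] by simp
  qed
  \<comment> \<open>The complementary digits fill each digit up to its maximum;
    \<open>n i < M i\<close> makes the truncated differences exact.\<close>
  have "top = comb N (greedy A) n + comb N (greedy A) (\<lambda>i. M i - 1 - n i)"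
    unfolding top_def comb_add
  proof (rule comb_cong[OF refl])
    fix i assume "i < N"
    then have "M i - 1 = n i + (M i - 1 - n i)" using n[of i] by simp
    then show "nmul (M i - 1) (greedy A i) = nmul (n i + (M i - 1 - n i)) (greedy A i)" by simp
  qed
  also have "\<dots> \<in> sumset A (p + (\<Sum>i<N. M i - 1 - n i))"
    by (intro sumset_add mem comb_in_sumset greedy_mem)
  finally have "top \<in> sumset A (p + (\<Sum>i<N. M i - 1 - n i))" .
  moreover have less: "p + (\<Sum>i<N. M i - 1 - n i) \<le> diam_bound - 1" "0 < diam_bound"
    using split p by linarith+
  ultimately have top: "top \<in> sumset A (diam_bound - 1)" using sumset_mono by blast
  obtain g where g: "g \<notin> sumset A (diam_bound - 1)"
    using extremal[rule_format, of "diam_bound - 1"] less by auto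
  obtain l where l: "\<And>i. i < N \<Longrightarrow> l i < M i" "g = comb N (greedy A) l"
    using extremal_expansion by blast
  have "g \<in> sumset A (\<Sum>i<N. l i)" unfolding l(2) by (intro comb_in_sumset greedy_mem)
  then have "diam_bound \<le> (\<Sum>i<N. l i)"
    using g sumset_mono[of "\<Sum>i<N. l i" "diam_bound - 1" A] by (cases "(\<Sum>i<N. l i) \<le> diam_bound - 1") auto
  moreover have "(\<Sum>i<N. l i) < diam_bound" if "j < N" "l j \<noteq> M j - 1" for j
    unfolding diam_bound_def
  proof (rule sum_strict_mono_ex1)
    show "\<forall>i\<in>{..<N}. l i \<le> M i - 1" using l(1) by fastforce
    show "\<exists>i\<in>{..<N}. l i < M i - 1" using l(1)[OF that(1)] that by (intro bexI[of _ j]) auto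
  qed simp
  ultimately have "\<And>i. i < N \<Longrightarrow> l i = M i - 1" by (meson not_le)
  then have "g = top" unfolding l(2) top_def by (intro comb_cong) auto
  then show False using top g by simp
qed

lemma extremal_unique: "unique_digits M N (greedy A)"
  using greedy_unique_digits[of A N] extremal_greedy_ord unfolding unique_digits_def by simp

text \<open>The \<open>\<Prod>j<k. M j div M k\<close> combinations with all digits divisible by \<open>M k\<close> are distinct, hence
  they exhaust \<open>M k G\<close>.\<close>

lemma extremal_divisible_digits:
  assumes "k < N"
  obtains n where "\<And>i. i < k \<Longrightarrow> M k * n i < M i" "nmul (M k) g = comb k (greedy A) (\<lambda>i. M k * n i)"
proof -
  let ?d = "M k" and ?q = "\<lambda>i. M i div M k"
  let ?f = "\<lambda>n. comb k (greedy A) (\<lambda>i. ?d * n i)"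
  have bound: "?d * n i < M i" if "n \<in> digits ?q k" "i < k" for n i
  proof -
    have "?d * n i < ?d * ?q i" using digits_less[OF that] M_pos by simp
    then show ?thesis using M_dvd[of i k] that(2) by simp
  qed
  have "inj_on ?f (digits ?q k)"
  proof (intro inj_onI digits_eqI)
    fix n n' i assume *: "n \<in> digits ?q k" "n' \<in> digits ?q k" "?f n = ?f n'" "i < k"
    \<comment> \<open>Uniqueness is available at full length \<open>N\<close>, so the combinations
      are padded with zero digits.\<close>
    let ?e = "\<lambda>n i. if i < k then ?d * n i else (0::nat)"
    have "comb N (greedy A) (?e n) = comb N (greedy A) (?e n')"
      using *(3) assms by (simp add: comb_extend)
    then have "?e n i = ?e n' i"
      using *(4) assms bound[OF *(1)] bound[OF *(2)] M_pos
      by (intro unique_digitsD[OF extremal_unique]) auto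
    then show "n i = n' i" using *(4) M_pos[of k] by simp
  qed
  then have "card (?f ` digits ?q k) = (\<Prod>i<k. ?q i)"
    by (simp add: card_image card_digits)
  moreover have sub: "?f ` digits ?q k \<subseteq> range (nmul ?d)"
    by (auto simp flip: nmul_comb)
  ultimately have "?f ` digits ?q k = range (nmul ?d)"
    using card_range_nmul_le[of k] assms by (intro card_seteq) auto
  then have "nmul ?d g \<in> ?f ` digits ?q k" by simp
  then obtain n where "n \<in> digits ?q k" "nmul ?d g = ?f n" by (elim imageE)
  then show ?thesis using that bound by blast
qed

text \<open>The digits of \<open>nmul (M k) (greedy A k)\<close> are \<open>M k * n i\<close>. By
  \<open>extremal_length\<close> their sum is at most \<open>M k\<close>, so the \<open>n i\<close>
  sum to 0 or 1, which gives the two alternatives.\<close>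

lemma extremal_relation:
  assumes "k < N"
  shows "nmul (M k) (greedy A k) = 0 \<or> (\<exists>j<k. nmul (M k) (greedy A k) = nmul (M k) (greedy A j))"
proof -
  obtain n where n: "\<And>i. i < k \<Longrightarrow> M k * n i < M i"
    "nmul (M k) (greedy A k) = comb k (greedy A) (\<lambda>i. M k * n i)"
    using extremal_divisible_digits[OF assms] by blast
  let ?e = "\<lambda>i. if i < k then M k * n i else 0"
  have "nmul (M k) (greedy A k) = comb N (greedy A) ?e"
    using n(2) assms by (simp add: comb_extend)
  then have "(\<Sum>i<N. ?e i) \<le> M k"
    using n(1) M_pos nmul_in_sumset[OF greedy_mem, of "M k" A k] by (intro extremal_length) auto
  moreover have "(\<Sum>i<N. ?e i) = (\<Sum>i<k. M k * n i)"
    using assms by (intro sum.mono_neutral_cong_right) auto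
  ultimately have "M k * (\<Sum>i<k. n i) \<le> M k * 1"
    by (simp add: sum_distrib_left)
  then have "(\<Sum>i<k. n i) \<le> 1"
    using M_pos[of k] unfolding mult_le_cancel1 by simp
  then consider "(\<Sum>i<k. n i) = 0" | "(\<Sum>i<k. n i) = 1" by linarith
  then show ?thesis
  proof cases
    case 1
    then have "comb k (greedy A) (\<lambda>i. M k * n i) = comb k (greedy A) (\<lambda>_. 0)"
      by (intro comb_cong) auto
    then show ?thesis using n(2) by simp
  next
    case 2
    then obtain j where j: "j < k" "n j = 1" "\<And>i. i < k \<Longrightarrow> i \<noteq> j \<Longrightarrow> n i = 0"
      by (subst (asm) sum_eq_1_iff) auto
    then have "comb k (greedy A) (\<lambda>i. M k * n i) = comb k (greedy A) (\<lambda>i. if i = j then M k else 0)"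
      by (intro comb_cong) auto
    then show ?thesis using n(2) j(1) by (auto simp: comb_single)
  qed
qed

text \<open>An element of \<open>A\<close> has length at most 1, hence is 0 or has a single nonzero
  digit 1; that digit needs \<open>M j > 1\<close> and so sits below \<open>r\<close>.\<close>

lemma extremal_subset:
  assumes "\<forall>i\<ge>r. M i = 1"
  shows "A \<subseteq> insert 0 (greedy A ` {..<r})"
proof
  fix a assume "a \<in> A"
  obtain n where n: "\<And>i. i < N \<Longrightarrow> n i < M i" "a = comb N (greedy A) n"
    using extremal_expansion by blast
  have "(\<Sum>i<N. n i) \<le> 1"
    using n \<open>a \<in> A\<close> sumset_1[of a A] by (intro extremal_length) auto
  then consider "(\<Sum>i<N. n i) = 0" | "(\<Sum>i<N. n i) = 1" by linarith
  then show "a \<in> insert 0 (greedy A ` {..<r})"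
  proof cases
    case 1
    then have "a = comb N (greedy A) (\<lambda>_. 0)" unfolding n(2) by (intro comb_cong) auto
    then show ?thesis by simp
  next
    case 2
    then obtain j where j: "j < N" "n j = 1" "\<And>i. i < N \<Longrightarrow> i \<noteq> j \<Longrightarrow> n i = 0"
      by (subst (asm) sum_eq_1_iff) auto
    then have "a = comb N (greedy A) (\<lambda>i. if i = j then 1 else 0)"
      unfolding n(2) by (intro comb_cong) auto
    then have "a = greedy A j" using comb_single[OF j(1), of "greedy A" 1] by simp
    moreover have "j < r" using n(1)[OF j(1)] j(2) assms by (cases "j < r") auto
    ultimately show ?thesis by blast
  qed
qed

lemma extremal_span:
  assumes "\<forall>i\<ge>r. M i = 1" "r \<le> N"
  shows "range (comb r (greedy A)) = UNIV"
proof -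
  have "g \<in> range (comb r (greedy A))" for g
  proof -
    obtain n where n: "\<And>i. i < N \<Longrightarrow> n i < M i" "g = comb N (greedy A) n"
      using extremal_expansion by blast
    have "g = comb N (greedy A) (\<lambda>i. if i < r then n i else 0)"
      unfolding n(2)
    proof (rule comb_cong[OF refl])
      fix i assume "i < N"
      then show "nmul (n i) (greedy A i) = nmul (if i < r then n i else 0) (greedy A i)"
        using n(1)[of i] assms(1) by (cases "i < r") auto
    qed
    then show ?thesis using comb_extend[OF assms(2)] by auto
  qed
  then show ?thesis by blast
qed

end

end

section \<open>Types and standard generating sets\<close>

lemma card_box: "card (box ms) = (\<Prod>i<length ms. ms ! i)"
proof -
  let ?r = "length ms"
  have "bij_betw (\<lambda>n. map n [0..<?r]) (digits ((!) ms) ?r) (box ms)"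
  proof (rule bij_betw_imageI)
    show "inj_on (\<lambda>n. map n [0..<?r]) (digits ((!) ms) ?r)"
      by (intro inj_onI digits_eqI) auto
    show "(\<lambda>n. map n [0..<?r]) ` digits ((!) ms) ?r = box ms"
    proof (intro equalityI subsetI)
      fix xs assume xs: "xs \<in> box ms"
      then have "xs = map (restrict ((!) xs) {..<?r}) [0..<?r]"
        by (intro nth_equalityI) (auto simp: box_def)
      moreover have "restrict ((!) xs) {..<?r} \<in> digits ((!) ms) ?r"
        using xs by (intro restrict_in_digits) (auto simp: box_def)
      ultimately show "xs \<in> (\<lambda>n. map n [0..<?r]) ` digits ((!) ms) ?r" by blast
    qed (auto simp: box_def digits_less)
  qed
  then show ?thesis by (metis bij_betw_same_card card_digits)
qed

text \<open>Torsion, generation and the group order are all that is kept of the type; together they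
  yield independence by counting.\<close>

locale abelian_type =
  fixes ms :: "nat list" and e :: "nat \<Rightarrow> 'a::{ab_group_add,finite}"
  assumes ms_gt_1: "i < length ms \<Longrightarrow> 1 < ms ! i"
    and ms_dvd: "i \<le> j \<Longrightarrow> j < length ms \<Longrightarrow> ms ! i dvd ms ! j"
    and e_torsion: "i < length ms \<Longrightarrow> nmul (ms ! i) (e i) = 0"
    and e_span: "range (comb (length ms) e) = UNIV"
    and card_UNIV: "card (UNIV :: 'a set) = (\<Prod>i<length ms. ms ! i)"

lemma has_type_abelian_type:
  assumes "has_type TYPE('a::{ab_group_add,finite}) ms"
  shows "\<exists>e :: nat \<Rightarrow> 'a. abelian_type ms e"
proof -
  let ?r = "length ms"
  obtain \<phi> :: "nat list \<Rightarrow> 'a" where bij: "bij_betw \<phi> (box ms) UNIV"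
    and hom: "\<And>x y. x \<in> box ms \<Longrightarrow> y \<in> box ms \<Longrightarrow> \<phi> (addmod ms x y) = \<phi> x + \<phi> y"
    using assms unfolding has_type_def by blast
  have step: "\<And>i. Suc i < ?r \<Longrightarrow> ms ! i dvd ms ! Suc i" and ms0: "ms \<noteq> [] \<Longrightarrow> ms ! 0 \<noteq> 1"
    using assms unfolding has_type_def by blast+
  have dvd: "ms ! i dvd ms ! j" if "i \<le> j" "j < ?r" for i j
    using that by (induction j rule: dec_induct) (auto intro: dvd_trans step)
  \<comment> \<open>The box is in bijection with a nonempty group, so no modulus is 0.\<close>
  have "box ms \<noteq> {}" using bij by (auto simp: bij_betw_def)
  then have pos: "0 < ms ! i" if "i < ?r" for i using that by (fastforce simp: box_def)
  have gt1: "1 < ms ! i" if "i < ?r" for i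
  proof -
    have "ms ! 0 dvd ms ! i" "ms ! 0 \<noteq> 1" using dvd[of 0 i] ms0 that by fastforce+
    then have "ms ! i \<noteq> 1" by auto
    then show ?thesis using pos[OF that] by simp
  qed
  \<comment> \<open>The map \<open>\<phi>\<close> is additive only on reduced vectors; reducing
    first makes \<open>\<phi> (v f)\<close> additive in arbitrary coefficient functions
    \<open>f\<close>.\<close>
  define v where "v f = map (\<lambda>j. f j mod ms ! j) [0..<?r]" for f :: "nat \<Rightarrow> nat"
  have v_box: "v f \<in> box ms" for f using pos by (auto simp: v_def box_def)
  have v_cong: "v f = v g" if "\<And>j. j < ?r \<Longrightarrow> f j mod ms ! j = g j mod ms ! j" for f g
    using that by (simp add: v_def)
  have v_add: "\<phi> (v f) + \<phi> (v g) = \<phi> (v (\<lambda>j. f j + g j))" for f g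
  proof -
    have "addmod ms (v f) (v g) = v (\<lambda>j. f j + g j)"
      by (auto simp: addmod_def v_def mod_add_eq)
    then show ?thesis using hom[OF v_box v_box, of f g] by simp
  qed
  have v_0: "\<phi> (v (\<lambda>_. 0)) = 0" using v_add[of "\<lambda>_. 0" "\<lambda>_. 0"] by simp
  have v_nmul: "nmul k (\<phi> (v f)) = \<phi> (v (\<lambda>j. k * f j))" for k f
    by (induction k) (simp_all add: v_0 v_add)
  define e where "e i = \<phi> (v (\<lambda>j. if j = i then 1 else 0))" for i
  have comb_e: "comb k e n = \<phi> (v (\<lambda>j. if j < k then n j else 0))" for k n
  proof (induction k)
    case (Suc k)
    have "comb (Suc k) e n = \<phi> (v (\<lambda>j. (if j < k then n j else 0) + n k * (if j = k then 1 else 0)))"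
      by (simp add: Suc e_def[of k] v_nmul v_add)
    also have "\<dots> = \<phi> (v (\<lambda>j. if j < Suc k then n j else 0))"
      by (intro arg_cong[of _ _ \<phi>] v_cong) (auto simp: less_Suc_eq)
    finally show ?case .
  qed (simp add: v_0)
  have "abelian_type ms e"
  proof
    fix i assume "i < ?r"
    have "nmul (ms ! i) (e i) = \<phi> (v (\<lambda>_. 0))"
      unfolding e_def v_nmul by (intro arg_cong[of _ _ \<phi>] v_cong) auto
    then show "nmul (ms ! i) (e i) = 0" by (simp add: v_0)
  next
    have "g \<in> range (comb ?r e)" for g
    proof -
      obtain x where x: "x \<in> box ms" "g = \<phi> x"
        using bij by (metis UNIV_I bij_betw_def imageE)
      have "x = v (\<lambda>j. if j < ?r then x ! j else 0)"
        using x(1) by (intro nth_equalityI) (auto simp: box_def v_def)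
      then have "g = comb ?r e ((!) x)" unfolding comb_e x(2) by simp
      then show ?thesis by blast
    qed
    then show "range (comb ?r e) = UNIV" by blast
  next
    show "card (UNIV :: 'a set) = (\<Prod>i<?r. ms ! i)"
      using bij_betw_same_card[OF bij] by (simp add: card_box)
  qed (use gt1 dvd in auto)
  then show ?thesis by blast
qed

section \<open>Standard generating sets by counting\<close>

context abelian_type
begin

text \<open>By torsion, digits \<open>n i < ms ! i\<close> suffice. There are as many digit vectors
  as group elements, so expansions are unique; exact orders and directness of the sum
  follow.\<close>

lemma std_genI:
  fixes es :: "'a list"
  assumes len: "length es = length ms"
    and torsion: "\<And>i. i < length ms \<Longrightarrow> nmul (ms ! i) (es ! i) = 0"
    and span: "range (comb (length ms) ((!) es)) = UNIV"
  shows "std_gen ms es"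
proof -
  let ?r = "length ms"
  have pos: "0 < ms ! i" if "i < ?r" for i using ms_gt_1[OF that] by simp
  have all: "all_digits ((!) ms) ?r ((!) es)"
    using torsion pos by (rule torsion_all_digits)
  then have unique: "unique_digits ((!) ms) ?r ((!) es)"
    by (rule unique_digitsI_card) (simp add: span card_UNIV)
  have ord: "ord_elem (es ! i) = ms ! i" if i: "i < ?r" for i
    unfolding ord_elem_def
  proof (rule Least_equality)
    fix k assume k: "0 < k \<and> nmul k (es ! i) = 0"
    show "ms ! i \<le> k"
    proof (rule ccontr)
      assume "\<not> ms ! i \<le> k"
      \<comment> \<open>Zero would have a second expansion, with the single digit \<open>k\<close>
        at \<open>i\<close>. The redundant test makes the term an instance of that digit
        function.\<close>
      then have "(if i = i then k else 0) = (0 :: nat)"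
        using k i pos
        by (intro unique_digitsD[OF unique, of "\<lambda>j. if j = i then k else 0" "\<lambda>_. 0"])
          (auto simp: comb_single)
      then show False using k by simp
    qed
  qed (use torsion pos i in auto)
  let ?P = "\<lambda>g hs. length hs = ?r \<and> (\<forall>i<?r. hs ! i \<in> cyc (es ! i)) \<and> g = sum_list hs"
  have ex: "\<exists>hs. ?P g hs" for g
  proof -
    obtain n where n: "g = comb ?r ((!) es) n" using span by (metis UNIV_I imageE)
    have "sum_list (map (\<lambda>i. nmul (n i) (es ! i)) [0..<?r]) = g"
      unfolding n comb_def by (simp add: sum_list_sum_nth atLeast0LessThan)
    then show ?thesis
      by (intro exI[of _ "map (\<lambda>i. nmul (n i) (es ! i)) [0..<?r]"]) (auto simp: cyc_def)
  qed
  have digits: "\<exists>n. (\<forall>i<?r. n i < ms ! i \<and> hs ! i = nmul (n i) (es ! i)) \<and> g = comb ?r ((!) es) n"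
    if "?P g hs" for g hs
  proof -
    have "\<forall>i<?r. \<exists>k. k < ms ! i \<and> hs ! i = nmul k (es ! i)"
    proof (intro allI impI)
      fix i assume i: "i < ?r"
      then have "hs ! i \<in> cyc (es ! i)" using that by blast
      then obtain k where "hs ! i = nmul k (es ! i)" unfolding cyc_def by blast
      then have "hs ! i = nmul (k mod ms ! i) (es ! i)" using nmul_mod[OF torsion[OF i]] by simp
      then show "\<exists>k. k < ms ! i \<and> hs ! i = nmul k (es ! i)"
        using pos[OF i] by (intro exI[of _ "k mod ms ! i"]) simp
    qed
    then obtain n where n: "\<And>i. i < ?r \<Longrightarrow> n i < ms ! i \<and> hs ! i = nmul (n i) (es ! i)" by metis
    have "g = (\<Sum>i<?r. hs ! i)" using that by (simp add: sum_list_sum_nth atLeast0LessThan)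
    also have "\<dots> = comb ?r ((!) es) n" unfolding comb_def using n by simp
    finally show ?thesis using n by blast
  qed
  have "hs = hs'" if hs: "?P g hs" and hs': "?P g hs'" for g hs hs'
  proof -
    obtain n where n: "\<forall>i<?r. n i < ms ! i \<and> hs ! i = nmul (n i) (es ! i)" "g = comb ?r ((!) es) n"
      using digits[OF hs] by blast
    obtain n' where n': "\<forall>i<?r. n' i < ms ! i \<and> hs' ! i = nmul (n' i) (es ! i)" "g = comb ?r ((!) es) n'"
      using digits[OF hs'] by blast
    have "n i = n' i" if "i < ?r" for i
      using n n' that by (intro unique_digitsD[OF unique]) auto
    then show ?thesis using n n' hs hs' by (intro nth_equalityI) auto
  qed
  with ex have "\<forall>g. \<exists>!hs. ?P g hs" by blast
  then show ?thesis using len ord unfolding std_gen_def by blast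
qed

lemma std_genD:
  fixes es :: "'a list"
  assumes "std_gen ms es"
  shows "i < length ms \<Longrightarrow> nmul (ms ! i) (es ! i) = 0"
    and "range (comb (length ms) ((!) es)) = UNIV"
proof -
  let ?r = "length ms"
  show "nmul (ms ! i) (es ! i) = 0" if "i < ?r"
  proof -
    have "ord_elem (es ! i) = ms ! i" using assms that unfolding std_gen_def by blast
    then show ?thesis
      using LeastI_ex[of "\<lambda>k. 0 < k \<and> nmul k (es ! i) = 0"] ex_nmul_zero[of "es ! i"]
      unfolding ord_elem_def by simp
  qed
  have "g \<in> range (comb ?r ((!) es))" for g
  proof -
    obtain hs where hs: "length hs = ?r" "\<forall>i<?r. hs ! i \<in> cyc (es ! i)" "g = sum_list hs"
      using assms unfolding std_gen_def by blast
    have "\<forall>i<?r. \<exists>k. hs ! i = nmul k (es ! i)" using hs(2) unfolding cyc_def by blast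
    then obtain n where "\<And>i. i < ?r \<Longrightarrow> hs ! i = nmul (n i) (es ! i)" by metis
    then have "g = comb ?r ((!) es) n"
      unfolding hs(3) comb_def using hs(1) by (simp add: sum_list_sum_nth atLeast0LessThan)
    then show ?thesis by blast
  qed
  then show "range (comb ?r ((!) es)) = UNIV" by blast
qed

definition max_diam :: nat where
  "max_diam = (\<Sum>i<length ms. ms ! i - 1)"

section \<open>Consequences of condition (ii)\<close>

context
  fixes A :: "'a set" and es as :: "'a list"
  assumes cond: "cond_ii ms A es as"
begin

lemma cond_ii_cases:
  assumes "i < length ms"
  shows "as ! i = es ! i \<or> (\<exists>j. i < j \<and> j < length ms \<and> as ! i = es ! i + as ! j)"
  using cond assms unfolding cond_ii_def by blast

lemma cond_ii_std_gen: "std_gen ms es"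
  using cond unfolding cond_ii_def by blast

text \<open>Multiplying \<open>as ! i = es ! i + as ! j\<close> by \<open>ms ! i\<close> kills
  \<open>es ! i\<close> and leaves the relation that carrying needs.\<close>

lemma cond_ii_carry:
  "\<exists>n'. (\<forall>i<length ms. n' i < ms ! i) \<and> comb (length ms) ((!) as) n' = comb (length ms) ((!) as) n \<and>
     (\<Sum>i<length ms. n' i) \<le> (\<Sum>i<length ms. n i)"
proof (rule carry)
  fix i assume i: "i < length ms"
  then show "0 < ms ! i" using ms_gt_1[OF i] by simp
  show "nmul (ms ! i) (as ! i) = 0 \<or>
    (\<exists>j. i < j \<and> j < length ms \<and> nmul (ms ! i) (as ! i) = nmul (ms ! i) (as ! j))"
    using cond_ii_cases[OF i] std_genD(1)[OF cond_ii_std_gen i] by (auto simp: nmul_add_right)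
qed

lemma cond_ii_span: "range (comb (length ms) ((!) as)) = UNIV"
proof (rule comb_eq_UNIV_transfer[OF std_genD(2)[OF cond_ii_std_gen]])
  fix i assume i: "i < length ms"
  have mem: "as ! j \<in> range (comb (length ms) ((!) as))" if "j < length ms" for j
    using that by (rule range_comb_member)
  from cond_ii_cases[OF i] show "es ! i \<in> range (comb (length ms) ((!) as))"
  proof (elim disjE exE conjE)
    assume "as ! i = es ! i"
    then show ?thesis using mem[OF i] by simp
  next
    fix j assume "j < length ms" "as ! i = es ! i + as ! j"
    then show ?thesis using range_comb_diff[OF mem[OF i] mem[of j]] by simp
  qed
qed

lemma cond_ii_all_digits: "all_digits ((!) ms) (length ms) ((!) as)"
  using cond_ii_carry unfolding all_digits_def by blast

lemma cond_ii_unique_digits: "unique_digits ((!) ms) (length ms) ((!) as)"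
  using cond_ii_all_digits by (rule unique_digitsI_card) (simp add: cond_ii_span card_UNIV)

lemma cond_ii_digits:
  obtains n where "\<And>i. i < length ms \<Longrightarrow> n i < ms ! i" "g = comb (length ms) ((!) as) n"
  using cond_ii_all_digits cond_ii_span unfolding all_digits_def by (metis UNIV_I imageE)

lemma cond_ii_set: "insert 0 A = insert 0 ((!) as ` {..<length ms})"
  using cond unfolding cond_ii_def by (auto simp: set_conv_nth)

lemma cond_ii_comb_in_sumset: "comb (length ms) ((!) as) n \<in> sumset A (\<Sum>i<length ms. n i)"
  by (rule comb_in_sumset) (simp add: cond_ii_set)

text \<open>An expression with \<open>p\<close> summands gives coefficients of sum at most
  \<open>p\<close>. Carrying turns them into digits without raising the sum, and by uniqueness these
  digits are \<open>n\<close>.\<close>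

lemma cond_ii_sum_digits_le:
  assumes "\<And>i. i < length ms \<Longrightarrow> n i < ms ! i" "comb (length ms) ((!) as) n \<in> sumset A p"
  shows "(\<Sum>i<length ms. n i) \<le> p"
proof -
  obtain l where l: "comb (length ms) ((!) as) n = comb (length ms) ((!) as) l" "(\<Sum>i<length ms. l i) \<le> p"
    using sumset_as_comb[OF equalityD1[OF cond_ii_set] assms(2)] by blast
  obtain l' where l': "\<forall>i<length ms. l' i < ms ! i" "comb (length ms) ((!) as) l' = comb (length ms) ((!) as) l"
    "(\<Sum>i<length ms. l' i) \<le> (\<Sum>i<length ms. l i)"
    using cond_ii_carry by blast
  have "n i = l' i" if "i < length ms" for i
    using l l' that assms(1) by (intro unique_digitsD[OF cond_ii_unique_digits]) auto
  then show ?thesis using l(2) l'(3) by simp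
qed

lemma cond_ii_lenA:
  assumes "\<And>i. i < length ms \<Longrightarrow> n i < ms ! i"
  shows "lenA A (comb (length ms) ((!) as) n) = enat (\<Sum>i<length ms. n i)"
  using cond_ii_comb_in_sumset cond_ii_sum_digits_le[OF assms] by (rule lenA_eqI)

text \<open>No digit sum exceeds \<open>max_diam\<close>, and the element with all digits maximal
  needs that many summands.\<close>

lemma cond_ii_diamA: "diamA A = enat max_diam"
proof (rule diamA_eq_enatI)
  have "g \<in> sumset A max_diam" for g
  proof -
    obtain n where n: "\<And>i. i < length ms \<Longrightarrow> n i < ms ! i" "g = comb (length ms) ((!) as) n"
      using cond_ii_digits by blast
    have "(\<Sum>i<length ms. n i) \<le> max_diam"
      unfolding max_diam_def using n(1) by (intro sum_mono) fastforce
    then show ?thesis unfolding n(2) using cond_ii_comb_in_sumset sumset_mono by blast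
  qed
  then show "sumset A max_diam = UNIV" by blast
next
  fix q assume "sumset A q = UNIV"
  then show "max_diam \<le> q"
    unfolding max_diam_def using ms_gt_1 by (intro cond_ii_sum_digits_le) fastforce+
qed

end

section \<open>The diameter of the group and the passage from (i) to (ii)\<close>

lemma cond_ii_set_std_gen: "std_gen ms es \<Longrightarrow> cond_ii ms (set es) es es"
  unfolding cond_ii_def std_gen_def by blast

lemma ex_std_gen: "\<exists>es :: 'a list. std_gen ms es"
proof
  show "std_gen ms (map e [0..<length ms])"
  proof (rule std_genI)
    have "comb (length ms) ((!) (map e [0..<length ms])) = comb (length ms) e"
      by (intro ext comb_cong) auto
    then show "range (comb (length ms) ((!) (map e [0..<length ms]))) = UNIV"
      by (simp add: e_span)
  qed (auto simp: e_torsion)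
qed

text \<open>The index reversal turns the divisibility chain \<open>ms\<close> into a decreasing one.\<close>

definition M :: "nat \<Rightarrow> nat" where
  "M i = (if i < length ms then ms ! (length ms - Suc i) else 1)"

text \<open>At least \<open>length ms\<close>, to hold all invariants, and at least the group order,
  so that \<open>N\<close> greedy steps span the group from any generating set.\<close>

definition N :: nat where
  "N = max (length ms) (card (UNIV :: 'a set))"

sublocale invariants M "\<lambda>i. if i < length ms then e (length ms - Suc i) else 0" N
proof
  fix i
  show "0 < M i" by (auto simp: M_def intro: less_trans[OF zero_less_one ms_gt_1])
next
  fix i j :: nat assume "i \<le> j"
  then show "M j dvd M i" by (auto simp: M_def intro: ms_dvd)
next
  fix i
  show "nmul (M i) (if i < length ms then e (length ms - Suc i) else 0) = 0"
    using e_torsion by (simp add: M_def)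
next
  let ?E = "\<lambda>i. if i < length ms then e (length ms - Suc i) else 0"
  show "range (comb N ?E) = UNIV"
  proof (rule comb_eq_UNIV_transfer[OF e_span])
    fix i assume i: "i < length ms"
    then have "length ms - Suc i < N" by (simp add: N_def)
    then have "?E (length ms - Suc i) \<in> range (comb N ?E)" by (rule range_comb_member)
    moreover have "length ms - Suc i < length ms" "length ms - Suc (length ms - Suc i) = i"
      using i by linarith+
    ultimately show "e i \<in> range (comb N ?E)" by (simp only: if_True)
  qed
next
  have "(\<Prod>i<N. M i) = (\<Prod>i<length ms. ms ! (length ms - Suc i))"
    by (rule prod.mono_neutral_cong_right) (auto simp: M_def N_def)
  then show "card (UNIV :: 'a set) = (\<Prod>i<N. M i)"
    by (simp add: card_UNIV prod.nat_diff_reindex)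
qed (simp add: N_def)

lemma diam_bound_eq: "diam_bound = max_diam"
proof -
  have "diam_bound = (\<Sum>i<length ms. ms ! (length ms - Suc i) - 1)"
    unfolding diam_bound_def by (rule sum.mono_neutral_cong_right) (auto simp: M_def N_def)
  then show ?thesis
    unfolding max_diam_def using sum.nat_diff_reindex[of "\<lambda>i. ms ! i - 1" "length ms"] by simp
qed

text \<open>The bound from majorization holds for every generating set, and a standard generating
  set, which satisfies (ii) with \<open>as = es\<close>, attains it.\<close>

lemma diamG_eq: "diamG TYPE('a) = enat max_diam"
proof -
  have "finite {diamA (B :: 'a set) | B. gen B = UNIV}"
    by (rule finite_subset[of _ "range diamA"]) auto
  moreover have "d \<le> enat max_diam" if "d \<in> {diamA (B :: 'a set) | B. gen B = UNIV}" for d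
    using that diamA_le[OF sumset_diam_bound] by (auto simp: diam_bound_eq)
  moreover have "enat max_diam \<in> {diamA (B :: 'a set) | B. gen B = UNIV}"
  proof -
    obtain es :: "'a list" where "std_gen ms es" using ex_std_gen by blast
    then have "diamA (set es) = enat max_diam" by (rule cond_ii_diamA[OF cond_ii_set_std_gen])
    moreover from this have "gen (set es) = UNIV"
      by (rule sumset_UNIV_imp_gen[OF diamA_eq_enatD(1)])
    ultimately show ?thesis by (intro CollectI exI[of _ "set es"]) simp
  qed
  ultimately show ?thesis unfolding diamG_def by (rule Max_eqI)
qed

text \<open>The greedy relations refer to earlier indices; reversing the order matches the
  divisibility chain \<open>ms\<close> and makes them refer to later ones, as (ii) demands.\<close>

lemma extremal_imp_cond_ii:
  fixes A :: "'a set"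
  assumes diam: "diamA A = enat max_diam"
  shows "\<exists>es as. cond_ii ms A es as"
proof -
  let ?r = "length ms"
  let ?b = "greedy A"
  have gen: "gen A = UNIV" using sumset_UNIV_imp_gen[OF diamA_eq_enatD(1)[OF diam]] .
  have ext: "\<forall>p<diam_bound. sumset A p \<noteq> UNIV"
    using diamA_eq_enatD(2)[OF diam] by (simp add: diam_bound_eq)
  have r: "?r \<le> N" and M_1: "\<forall>i\<ge>?r. M i = 1" by (auto simp: N_def M_def)
  \<comment> \<open>Here \<open>x\<close> is the future standard generator: \<open>?b k\<close>
    itself or a difference \<open>?b k - ?b j\<close>, whichever is killed by
    \<open>M k\<close>.\<close>
  have "\<forall>k<?r. \<exists>x. nmul (M k) x = 0 \<and> (?b k = x \<or> (\<exists>j<k. ?b k = x + ?b j))"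
  proof (intro allI impI)
    fix k assume "k < ?r"
    then have "k < N" using r by simp
    from extremal_relation[OF gen ext this]
    show "\<exists>x. nmul (M k) x = 0 \<and> (?b k = x \<or> (\<exists>j<k. ?b k = x + ?b j))"
    proof (elim disjE exE conjE)
      fix j assume "j < k" "nmul (M k) (?b k) = nmul (M k) (?b j)"
      then show ?thesis by (intro exI[of _ "?b k - ?b j"]) (auto simp: nmul_diff_right)
    qed blast
  qed
  then obtain f where f: "\<And>k. k < ?r \<Longrightarrow> nmul (M k) (f k) = 0"
    "\<And>k. k < ?r \<Longrightarrow> ?b k = f k \<or> (\<exists>j<k. ?b k = f k + ?b j)"
    by metis
  define es where "es = map (\<lambda>i. f (?r - Suc i)) [0..<?r]"
  define as where "as = map (\<lambda>i. ?b (?r - Suc i)) [0..<?r]"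
  have "std_gen ms es"
  proof (rule std_genI)
    show "nmul (ms ! i) (es ! i) = 0" if "i < ?r" for i
      using f(1)[of "?r - Suc i"] that by (simp add: es_def M_def)
    \<comment> \<open>It suffices to recover each \<open>?b k\<close>, inductively from
      \<open>f k\<close> and possibly an earlier \<open>?b j\<close>.\<close>
    show "range (comb ?r ((!) es)) = UNIV"
    proof (rule comb_eq_UNIV_transfer[OF extremal_span[OF gen ext M_1 r]])
      fix k assume "k < ?r"
      then show "?b k \<in> range (comb ?r ((!) es))"
      proof (induction k rule: less_induct)
        case (less k)
        have fk: "f k \<in> range (comb ?r ((!) es))"
          using range_comb_member[of "?r - Suc k" ?r "(!) es"] less.prems by (simp add: es_def)
        from f(2)[OF less.prems] show ?case
        proof (elim disjE exE conjE)
          fix j assume "j < k" "?b k = f k + ?b j"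
          then show ?thesis using range_comb_add[OF fk less.IH[of j]] less.prems by simp
        qed (use fk in simp)
      qed
    qed
  qed (simp add: es_def)
  moreover have "insert 0 A = insert 0 (set as)"
  proof -
    have "set as = ?b ` {..<?r}"
    proof (intro equalityI subsetI)
      fix x assume "x \<in> ?b ` {..<?r}"
      then obtain k where "k < ?r" "x = ?b k" by auto
      then show "x \<in> set as"
        by (auto simp: as_def intro!: image_eqI[of _ _ "?r - Suc k"])
    qed (auto simp: as_def)
    moreover have "?b ` {..<?r} \<subseteq> insert 0 A" using greedy_mem by auto
    ultimately show ?thesis using extremal_subset[OF gen ext M_1] by auto
  qed
  moreover have "as ! i = es ! i \<or> (\<exists>j. i < j \<and> j < ?r \<and> as ! i = es ! i + as ! j)" if i: "i < ?r" for i
  proof -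
    have "?r - Suc i < ?r" using i by simp
    from f(2)[OF this] show ?thesis
    proof (elim disjE exE conjE)
      fix j assume "j < ?r - Suc i" "?b (?r - Suc i) = f (?r - Suc i) + ?b j"
      \<comment> \<open>After reversal \<open>?b j\<close> sits at position
        \<open>?r - Suc j\<close>, which is beyond \<open>i\<close> because
        \<open>j < ?r - Suc i\<close>.\<close>
      then show ?thesis
        using i by (intro disjI2 exI[of _ "?r - Suc j"]) (auto simp: as_def es_def)
    qed (use i in \<open>simp add: as_def es_def\<close>)
  qed
  ultimately show ?thesis
    by (intro exI[of _ es] exI[of _ as]) (auto simp: cond_ii_def as_def)
qed

end

theorem theorem2p2:
  fixes A :: "'a::{ab_group_add,finite} set" and ms :: "nat list"
  assumes "has_type TYPE('a) ms"
  shows "(diamA A = diamG TYPE('a) \<longleftrightarrow> (\<exists>es as. cond_ii ms A es as)) \<and>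
    (\<forall>es as. cond_ii ms A es as \<longrightarrow>
      (\<forall>g::'a.
        (\<exists>!lam. length lam = length ms \<and> (\<forall>i<length ms. lam ! i < ms ! i) \<and>
               g = (\<Sum>i<length ms. nmul (lam ! i) (as ! i))) \<and>
        (\<forall>lam. length lam = length ms \<and> (\<forall>i<length ms. lam ! i < ms ! i) \<and>
               g = (\<Sum>i<length ms. nmul (lam ! i) (as ! i)) \<longrightarrow>
               lenA A g = enat (\<Sum>i<length ms. lam ! i))))"
proof -
  obtain e :: "nat \<Rightarrow> 'a" where "abelian_type ms e"
    using has_type_abelian_type[OF assms] by blast
  then interpret abelian_type ms e .
  \<comment> \<open>The statement speaks of digit lists, the lemmas of digit functions;
    \<open>(!) lam\<close> links the two.\<close>
  have sum_comb: "(\<Sum>i<length ms. nmul (lam ! i) (as ! i)) = comb (length ms) ((!) as) ((!) lam)"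
    for lam and as :: "'a list"
    by (simp add: comb_def)
  have "\<exists>!lam. length lam = length ms \<and> (\<forall>i<length ms. lam ! i < ms ! i) \<and>
      g = (\<Sum>i<length ms. nmul (lam ! i) (as ! i))" (is "\<exists>!lam. ?P lam")
    if cond: "cond_ii ms A es as" for es as and g :: 'a
  proof -
    obtain n where n: "\<And>i. i < length ms \<Longrightarrow> n i < ms ! i" "g = comb (length ms) ((!) as) n"
      using cond_ii_digits[OF cond] by blast
    have "?P (map n [0..<length ms])"
      unfolding sum_comb n(2) using n(1) by (auto intro: comb_cong)
    moreover have "lam = lam'" if "?P lam" "?P lam'" for lam lam'
    proof (rule nth_equalityI)
      fix i assume "i < length lam"
      then show "lam ! i = lam' ! i"
        using that unfolding sum_comb
        by (intro unique_digitsD[OF cond_ii_unique_digits[OF cond], of "(!) lam" "(!) lam'"]) auto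
    qed (use that in simp)
    ultimately show ?thesis by blast
  qed
  moreover have "lenA A g = enat (\<Sum>i<length ms. lam ! i)"
    if "cond_ii ms A es as" "length lam = length ms \<and> (\<forall>i<length ms. lam ! i < ms ! i) \<and>
      g = (\<Sum>i<length ms. nmul (lam ! i) (as ! i))" for es as lam and g :: 'a
    using cond_ii_lenA[OF that(1), of "(!) lam"] that(2) unfolding sum_comb by simp
  moreover have "diamA A = diamG TYPE('a) \<longleftrightarrow> (\<exists>es as. cond_ii ms A es as)"
    unfolding diamG_eq using extremal_imp_cond_ii cond_ii_diamA by blast
  ultimately show ?thesis by blast
qed

end
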